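(* There exists a threshold value $\varrho>0$ such that for every $\rho\in(0,\varrho]$ the following holds. Let $\{x_k\}$ be the sequence of points generated by Algorithm DFN-LLA applied to the perturbed penalty function $R_\rho$ when $\zeta_0>\bar\zeta=0$. Let $\bar x$ be any limit point of $\{x_k\}$ and $K$ an infinite subset of indices such that $$\lim_{k\to\infty,\,k\in K}x_k=\bar x .$$ If the subsequence $\{d_k\}_{k\in K}$ of directions is dense in the unit sphere $S(0,1)$, then $\bar x$ is Clarke-KKT stationary for the problem $\min_{x\in X}\bar F(x)$ subject to $\bar H(x)\le0$.
   Context: **Problem and standing assumptions.** Let $l,u\in\mathbb{R}^{n_x}$ and $X=\{x\in\mathbb{R}^{n_x}: l_i\le x_i\le u_i,\ i=1,\dots,n_x\}$. Let $F:\mathbb{R}^{n_x+n_y}\to\mathbb{R}$ and $H=(H_1,\dots,H_m):\mathbb{R}^{n_x+n_y}\to\mathbb{R}^m$ (upper-level objective and constraints), $f:\mathbb{R}^{n_x+n_y}\to\mathbb{R}$ (lower-level objective), $\mathcal{Z}\subseteq\mathbb{R}^{n_y}$, and $\mathcal{R}(x)=\arg\min_{z\in\mathcal{Z}}f(x,z)$. Throughout, assume: there are mappings $y:\mathbb{R}^{n_x}\to\mathbb{R}^{n_y}$ and $\tilde y:\mathbb{R}^{n_x}\times\mathbb{R}\to\mathbb{R}^{n_y}$ such that for all $x\in X$, $\zeta>0$: (a) $y(x)\in\mathcal{R}(x)$; (b) $\|\tilde y(x,\zeta)-y(x)\|\le\zeta$. Put $\bar F(x)=F(x,y(x))$ and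 $\bar H_i(x)=H_i(x,y(x))$, $\bar H=(\bar H_1,\dots,\bar H_m)$. Assume also: - $F(x,y)$ is Lipschitz continuous with respect to $y$ with constant $L_F$; $\bar F$ is Lipschitz continuous with constant $L_{\bar F}$; there is $F_{low}>-\infty$ with $\bar F(x)\ge F_{low}$ for all $x\in X$. - For $i=1,\dots,m$: $H_i(x,y)$ is Lipschitz continuous with respect to $y$ with constant $L_{H_i}$, and $\bar H_i$ is Lipschitz continuous with constant $L_{\bar H_i}$. - (EMFCQ) For any $x\in X\setminus\mathrm{int}\{x\in\mathbb{R}^{n_x}:\bar H(x)\le0\}$ there is a direction $d\in D(x)$ such that $(\xi^{\bar H_i})^\top d<0$ for all $\xi^{\bar H_i}\in\partial\bar H_i(x)$ and all $i\in\{1,\dots,m:\bar H_i(x)\ge0\}$. Here $D(x)=\{d\in\mathbb{R}^{n_x}: d_i\ge0\text{ if }x_i=l_i,\ d_i\le0\text{ if }x_i=u_i,\ d_i\in\mathbb{R}\text{ otherwise}\}$, and $\partial$ is the Clarke subdifferential: $\partial g(\bar x)=\{\xi: g^{Cl}(\bar x,d)\ge\xi^\top d\ \forall d\}$ with $g^{Cl}(\bar x,d)=\limsup_{x\to\bar x,\,t\downarrow0}\frac{g(x+td)-g(x)}{t}$. **Perturbed penalty function.** For $\rho>0$, $$R_\rho(x,\zeta)=F(x,\tilde y(x,\zeta))+\frac1\rho\max\{0,H_1(x,\tilde y(x,\zeta)),\dots,H_m(x,\tilde y(x,\zeta))\}.$$ **Notation.** $\|\cdot\|$ is the Euclidean norm;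 $[x]_{[l,u]}=\max\{l,\min\{u,x\}\}$ (componentwise) is the projection onto $X$; $S(0,1)=\{x\in\mathbb{R}^{n_x}:\|x\|=1\}$. **Procedure ProjectedExtrapolation$(\tilde\alpha,x,d,\zeta)$** (for $R_\rho$), with constants $\gamma>0$, $\hat\delta\in(0,1)$. Set $\alpha=\tilde\alpha$. If $R_\rho([x+\alpha d]_{[l,u]},\zeta)\le R_\rho(x,\zeta)-\gamma\alpha^2$, set $p^+=d$; else if $R_\rho([x-\alpha d]_{[l,u]},\zeta)\le R_\rho(x,\zeta)-\gamma\alpha^2$, set $p^+=-d$; else return $(0,d)$. Then loop: set $\beta=\alpha/\hat\delta$; if $R_\rho([x+\beta p^+]_{[l,u]},\zeta)>R_\rho(x,\zeta)-\gamma\beta^2$, return $(\alpha,p^+)$; otherwise set $\alpha=\beta$ and repeat the loop. **Algorithm DFN-LLA** (applied to $R_\rho$). Input: $\theta\in(0,1)$, $\sigma\in(0,1)$, $\bar\zeta\ge0$, $x_0\in X$, directions $\{d_k\}\subset\mathbb{R}^{n_x}$ with $\|d_k\|=1$ for all $k$. Set $\alpha_{\min}=(\sigma\bar\zeta)^{1/3}$, choose $\zeta_0\ge\bar\zeta$ and $\tilde\alpha_0\ge\zeta_0^{1/3}$. For $k=0,1,2,\dots$: let $(\alpha_k,\tilde d_k)=$ ProjectedExtrapolation$(\tilde\alpha_k,x_k,d_k,\zeta_k)$. - If $\alpha_k=0$ (unsuccessful iteration): $\tilde\alpha_{k+1}=\max\{\alpha_{\min},\theta\tilde\alpha_k\}$,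 $x_{k+1}=x_k$; and $\zeta_{k+1}=\max\{\bar\zeta,\min\{\theta\zeta_k,\tilde\alpha_{k+1}^3\}\}$ if $\tilde\alpha_{k+1}^3<\zeta_k$, while $\zeta_{k+1}=\zeta_k$ otherwise. - If $\alpha_k>0$ (successful iteration): $\tilde\alpha_{k+1}=\alpha_k$, $\tilde x_k=[x_k+\alpha_k\tilde d_k]_{[l,u]}$, $\zeta_{k+1}=\zeta_k$, and $x_{k+1}$ is any point of $X$ with $R_\rho(x_{k+1},\zeta_k)\le R_\rho(\tilde x_k,\zeta_k)$. There is no stopping condition. The input data of the problem and of the algorithm other than $\rho$ are fixed. **Density.** For an infinite index set $K$, $\{d_k\}_{k\in K}$ is dense in $S(0,1)$ if for any $\bar d\in S(0,1)$ and any $\varepsilon>0$ there is $k\in K$ with $\|d_k-\bar d\|\le\varepsilon$. **Clarke-KKT stationarity.** A feasible point $\bar x$ (i.e. $\bar x\in X$, $\bar H(\bar x)\le0$) is Clarke-KKT stationary for $\min_{x\in X}\bar F(x)$ s.t. $\bar H(x)\le0$ if there are multipliers $\bar\lambda_1,\dots,\bar\lambda_m\in\mathbb{R}$ with $\bar\lambda_i\ge0$, $\bar\lambda_i\bar H_i(\bar x)=0$, $\bar H_i(\bar x)\le0$ for all $i$, such that for every $d\in D(\bar x)$, $$\max\Big\{d^\top\xi:\ \xi\in\partial\bar F(\bar x)+\sum_{i=1}^m\bar\lambda_i\,\partial\bar H_i(\bar x)\Big\}\ge0 .$$ *)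

theory Defs
  imports "HOL-Analysis.Analysis"
begin

definition lower_level_solutions ::
  "((real^'n) \<times> (real^'p) \<Rightarrow> real) \<Rightarrow> (real^'p) set \<Rightarrow> real^'n \<Rightarrow> (real^'p) set" where
  "lower_level_solutions f Z x = {z. is_arg_min (\<lambda>z. f (x, z)) (\<lambda>z. z \<in> Z) z}"

definition at_response :: "('a \<times> 'b \<Rightarrow> 'c) \<Rightarrow> ('a \<Rightarrow> 'b) \<Rightarrow> 'a \<Rightarrow> 'c" where
  "at_response G y x = G (x, y x)"

definition box_proj :: "real^'n \<Rightarrow> real^'n \<Rightarrow> real^'n \<Rightarrow> real^'n" where
  "box_proj l u x = (\<chi> i. max (l $ i) (min (u $ i) (x $ i)))"

definition feasible_cone :: "real^'n \<Rightarrow> real^'n \<Rightarrow> real^'n \<Rightarrow> (real^'n) set" where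
  "feasible_cone l u x =
     {d. \<forall>i. (x $ i = l $ i \<longrightarrow> 0 \<le> d $ i) \<and> (x $ i = u $ i \<longrightarrow> d $ i \<le> 0)}"

text \<open>
  The upper limit is taken in the extended reals, so no boundedness is presupposed. The base
  point may coincide with the limit point (hence \<^const>\<open>nhds\<close> and not \<^const>\<open>at\<close>).
\<close>

definition clarke_dderiv :: "(real^'n \<Rightarrow> real) \<Rightarrow> real^'n \<Rightarrow> real^'n \<Rightarrow> ereal" where
  "clarke_dderiv g xbar d =
     Limsup (nhds xbar \<times>\<^sub>F at_right 0) (\<lambda>(x, t). ereal ((g (x + t *\<^sub>R d) - g x) / t))"

definition clarke_subdiff :: "(real^'n \<Rightarrow> real) \<Rightarrow> real^'n \<Rightarrow> (real^'n) set" where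
  "clarke_subdiff g xbar = {\<xi>. \<forall>d. ereal (\<xi> \<bullet> d) \<le> clarke_dderiv g xbar d}"

definition EMFCQ :: "real^'n \<Rightarrow> real^'n \<Rightarrow> (real^'n \<Rightarrow> real^'m) \<Rightarrow> bool" where
  "EMFCQ l u Hbar \<longleftrightarrow>
     (\<forall>x \<in> cbox l u - interior {x. \<forall>i. Hbar x $ i \<le> 0}.
        \<exists>d \<in> feasible_cone l u x.
          \<forall>i. 0 \<le> Hbar x $ i \<longrightarrow> (\<forall>\<xi> \<in> clarke_subdiff (\<lambda>x. Hbar x $ i) x. \<xi> \<bullet> d < 0))"

definition perturbed_penalty ::
  "((real^'n) \<times> (real^'p) \<Rightarrow> real) \<Rightarrow> ((real^'n) \<times> (real^'p) \<Rightarrow> real^'m) \<Rightarrow>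
   (real^'n \<Rightarrow> real \<Rightarrow> real^'p) \<Rightarrow> real \<Rightarrow> real^'n \<Rightarrow> real \<Rightarrow> real" where
  "perturbed_penalty F H ytilde \<rho> x \<zeta> =
     F (x, ytilde x \<zeta>) + 1 / \<rho> * Max (insert 0 (range (\<lambda>i. H (x, ytilde x \<zeta>) $ i)))"

definition sufficient_decrease ::
  "(real^'n \<Rightarrow> real \<Rightarrow> real) \<Rightarrow> real^'n \<Rightarrow> real^'n \<Rightarrow> real \<Rightarrow> real^'n \<Rightarrow> real \<Rightarrow> real \<Rightarrow> real^'n \<Rightarrow> bool"
where
  "sufficient_decrease R l u \<gamma> x \<zeta> \<alpha> p \<longleftrightarrow>
     R (box_proj l u (x + \<alpha> *\<^sub>R p)) \<zeta> \<le> R x \<zeta> - \<gamma> * \<alpha>\<^sup>2"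

text \<open>
  The expansion loop started at step \<open>\<alpha>\<close> returns step \<open>\<alpha>'\<close>. It is given as a relation because for
  an arbitrary \<open>R\<close> the loop need not terminate, in which case there is no result; it terminates
  if \<open>R\<close> is bounded below on the box at \<open>\<zeta>\<close> and \<open>\<alpha> > 0\<close>, \<open>\<gamma> > 0\<close>, \<open>0 < \<delta> < 1\<close>.
\<close>

inductive expansion_loop ::
  "(real^'n \<Rightarrow> real \<Rightarrow> real) \<Rightarrow> real^'n \<Rightarrow> real^'n \<Rightarrow> real \<Rightarrow> real \<Rightarrow> real^'n \<Rightarrow> real \<Rightarrow> real^'n \<Rightarrow>
   real \<Rightarrow> real \<Rightarrow> bool"
  for R l u \<gamma> \<delta> x \<zeta> p
where
  stop: "\<not> sufficient_decrease R l u \<gamma> x \<zeta> (\<alpha> / \<delta>) p \<Longrightarrow> expansion_loop R l u \<gamma> \<delta> x \<zeta> p \<alpha> \<alpha>"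
| expand: "sufficient_decrease R l u \<gamma> x \<zeta> (\<alpha> / \<delta>) p \<Longrightarrow>
    expansion_loop R l u \<gamma> \<delta> x \<zeta> p (\<alpha> / \<delta>) \<alpha>' \<Longrightarrow> expansion_loop R l u \<gamma> \<delta> x \<zeta> p \<alpha> \<alpha>'"

text \<open>The last two arguments are the returned step and direction.\<close>

definition projected_extrapolation ::
  "(real^'n \<Rightarrow> real \<Rightarrow> real) \<Rightarrow> real^'n \<Rightarrow> real^'n \<Rightarrow> real \<Rightarrow> real \<Rightarrow>
   real \<Rightarrow> real^'n \<Rightarrow> real^'n \<Rightarrow> real \<Rightarrow> real \<Rightarrow> real^'n \<Rightarrow> bool" where
  "projected_extrapolation R l u \<gamma> \<delta> \<alpha>t x d \<zeta> \<alpha> p \<longleftrightarrow>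
     (if sufficient_decrease R l u \<gamma> x \<zeta> \<alpha>t d
      then p = d \<and> expansion_loop R l u \<gamma> \<delta> x \<zeta> d \<alpha>t \<alpha>
      else if sufficient_decrease R l u \<gamma> x \<zeta> \<alpha>t (- d)
      then p = - d \<and> expansion_loop R l u \<gamma> \<delta> x \<zeta> (- d) \<alpha>t \<alpha>
      else \<alpha> = 0 \<and> p = d)"

text \<open>
  The sequences \<open>x\<close>, \<open>\<alpha>t\<close>, \<open>\<zeta>\<close>, \<open>\<alpha>\<close>, \<open>dt\<close> (iterates, tentative steps, accuracies, accepted steps,
  accepted directions) form a run of the algorithm on the input \<open>R\<close>, \<open>l\<close>, \<open>u\<close>, \<open>\<gamma>\<close>, \<open>\<delta>\<close>, \<open>\<theta>\<close>,
  \<open>\<sigma>\<close>, \<open>\<zeta>bar\<close>, \<open>x0\<close>, \<open>d\<close>. This is a relation since the initial values of \<open>\<zeta>\<close> and \<open>\<alpha>t\<close> and the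
  iterate after a successful iteration are free choices.
\<close>

definition DFN_LLA_run ::
  "(real^'n \<Rightarrow> real \<Rightarrow> real) \<Rightarrow> real^'n \<Rightarrow> real^'n \<Rightarrow> real \<Rightarrow> real \<Rightarrow>
   real \<Rightarrow> real \<Rightarrow> real \<Rightarrow> real^'n \<Rightarrow> (nat \<Rightarrow> real^'n) \<Rightarrow>
   (nat \<Rightarrow> real^'n) \<Rightarrow> (nat \<Rightarrow> real) \<Rightarrow> (nat \<Rightarrow> real) \<Rightarrow> (nat \<Rightarrow> real) \<Rightarrow> (nat \<Rightarrow> real^'n) \<Rightarrow> bool" where
  "DFN_LLA_run R l u \<gamma> \<delta> \<theta> \<sigma> \<zeta>bar x0 d x \<alpha>t \<zeta> \<alpha> dt \<longleftrightarrow>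
     x 0 = x0 \<and> \<zeta> 0 \<ge> \<zeta>bar \<and> \<alpha>t 0 \<ge> root 3 (\<zeta> 0) \<and>
     (\<forall>k. projected_extrapolation R l u \<gamma> \<delta> (\<alpha>t k) (x k) (d k) (\<zeta> k) (\<alpha> k) (dt k) \<and>
       (\<alpha> k = 0 \<longrightarrow>
          \<alpha>t (Suc k) = max (root 3 (\<sigma> * \<zeta>bar)) (\<theta> * \<alpha>t k) \<and>
          x (Suc k) = x k \<and>
          \<zeta> (Suc k) = (if (\<alpha>t (Suc k))^3 < \<zeta> k
                       then max \<zeta>bar (min (\<theta> * \<zeta> k) ((\<alpha>t (Suc k))^3)) else \<zeta> k)) \<and>
       (\<alpha> k > 0 \<longrightarrow>
          \<alpha>t (Suc k) = \<alpha> k \<and>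
          \<zeta> (Suc k) = \<zeta> k \<and>
          x (Suc k) \<in> cbox l u \<and>
          R (x (Suc k)) (\<zeta> k) \<le> R (box_proj l u (x k + \<alpha> k *\<^sub>R dt k)) (\<zeta> k)))"

definition dense_in_sphere :: "(nat \<Rightarrow> real^'n) \<Rightarrow> nat set \<Rightarrow> bool" where
  "dense_in_sphere d K \<longleftrightarrow> (\<forall>dbar \<in> sphere 0 1. \<forall>\<epsilon>>0. \<exists>k\<in>K. norm (d k - dbar) \<le> \<epsilon>)"

text \<open>
  The condition on the maximum of \<open>d \<bullet> \<xi>\<close> is stated with its attainment: some \<open>\<xi>\<close> in the set
  attains the maximum, and the maximal value is nonnegative.
\<close>

definition clarke_KKT ::
  "real^'n \<Rightarrow> real^'n \<Rightarrow> (real^'n \<Rightarrow> real) \<Rightarrow> (real^'n \<Rightarrow> real^'m) \<Rightarrow> real^'n \<Rightarrow> bool" where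
  "clarke_KKT l u Fbar Hbar xbar \<longleftrightarrow>
     xbar \<in> cbox l u \<and> (\<forall>i. Hbar xbar $ i \<le> 0) \<and>
     (\<exists>mult :: real^'m.
        (\<forall>i. 0 \<le> mult $ i \<and> mult $ i * Hbar xbar $ i = 0) \<and>
        (\<forall>d \<in> feasible_cone l u xbar.
           let S = {\<xi>F + (\<Sum>i\<in>UNIV. mult $ i *\<^sub>R \<xi>H i) | \<xi>F \<xi>H.
                      \<xi>F \<in> clarke_subdiff Fbar xbar \<and>
                      (\<forall>i. \<xi>H i \<in> clarke_subdiff (\<lambda>x. Hbar x $ i) xbar)}
           in \<exists>\<xi>\<in>S. (\<forall>\<eta>\<in>S. d \<bullet> \<eta> \<le> d \<bullet> \<xi>) \<and> 0 \<le> d \<bullet> \<xi>))"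

end

theory Submission
  imports Defs
begin

text \<open>
  The idea is to read the algorithm as a descent method for the exact penalty function
  \<open>P x = F\<^bsub>bar\<^esub> x + (1/\<rho>) max {0, H\<^bsub>bar\<^esub> x}\<close>, of which it sees only perturbed values, and to transfer
  stationarity of \<open>P\<close> on the box to stationarity of the constrained problem.

  \<^emph>\<open>Limit points are stationary for\<close> \<open>P\<close>. The perturbation at accuracy \<open>\<zeta>\<close> is \<open>O(\<zeta>)\<close>, and the
  algorithm keeps \<open>\<zeta>\<close> below the cube of the tentative step (\<open>invariant\<close>). Accepted steps decrease the
  perturbed value quadratically in the step, while changes of \<open>\<zeta>\<close> raise it by a total that is bounded
  by a geometric series; so the squares of the accepted steps are summable and all steps tend to
  zero (\<open>potential_decrease\<close>, \<open>tentative_steps_vanish\<close>). Each iteration also leaves a rejected step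
  along \<open>d k\<close> (\<open>rejected_steps\<close>). If some feasible direction \<open>e\<close> were a descent direction of \<open>P\<close> at the
  limit point, in the sense of a negative Clarke derivative, then short steps along directions close
  to \<open>e\<close> from points close to the limit would all be accepted, because a linear gain beats quadratic
  and cubic terms (\<open>descent_is_accepted\<close>). By density the directions come close to \<open>e\<close>, a
  contradiction (\<open>limit_point_no_descent\<close>). Density alone gives this infinitely often only if the
  sphere has no isolated points. In dimension one it has, and there the trial along \<open>- e\<close> is
  rejected near the limit, which makes the algorithm try \<open>e\<close> (\<open>opposite_trial_rejected\<close>).

  \<^emph>\<open>Stationary points of\<close> \<open>P\<close> \<^emph>\<open>are feasible if\<close> \<open>\<rho>\<close> \<^emph>\<open>is small.\<close> At an infeasible point the
  qualification condition yields a feasible direction along which the violation decreases at some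
  rate \<open>c\<close>, which beats the objective if \<open>\<rho>\<close> is small against \<open>c\<close>. The rate is locally uniform, and
  the box without the interior of the feasible set is compact, hence one threshold for \<open>\<rho>\<close> works
  everywhere (\<open>penalty_threshold\<close>).

  \<^emph>\<open>Feasible stationary points of\<close> \<open>P\<close> \<^emph>\<open>are Clarke-KKT.\<close> The slopes attainable by the objective and
  the active constraints along feasible directions form a convex cone which avoids the slopes that
  would let \<open>P\<close> decrease; a separating hyperplane provides the multipliers
  (\<open>multipliers_of_inconsistent_slopes\<close>).

  All three parts speak of slopes that hold uniformly near a point. The passage to Clarke
  subgradients is the Hahn-Banach argument \<open>clarke_subdiff_attains\<close>.
\<close>

section \<open>Clarke slopes\<close>

text \<open>
  For Lipschitz functions the admissible \<open>c\<close> are the upper bounds of the Clarke derivative, up to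
  the boundary value itself. Working with the bounds instead of the derivative keeps everything in
  the reals and turns upper limits into statements that hold eventually.
\<close>

definition slope_le :: "('a::real_normed_vector \<Rightarrow> real) \<Rightarrow> 'a \<Rightarrow> 'a \<Rightarrow> real \<Rightarrow> bool" where
  "slope_le g x d c \<longleftrightarrow>
     (\<forall>\<^sub>F (z, t) in nhds x \<times>\<^sub>F at_right 0. g (z + t *\<^sub>R d) - g z \<le> c * t)"

lemma tendsto_fst_nhds_at_right: "(fst \<longlongrightarrow> x) (nhds x \<times>\<^sub>F at_right (0::real))"
  by (rule filterlim_fst)

lemma tendsto_snd_nhds_at_right: "(snd \<longlongrightarrow> 0) (nhds x \<times>\<^sub>F at_right (0::real))"
  using filterlim_snd[of "at_right (0::real)" "nhds x"]
  by (rule filterlim_mono) (auto simp: at_within_def)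

lemma eventually_step_pos: "\<forall>\<^sub>F p in nhds x \<times>\<^sub>F at_right (0::real). 0 < snd p"
  using filterlim_snd[of "at_right (0::real)" "nhds x"]
  by (rule filterlim_iff[THEN iffD1, rule_format])
     (simp add: eventually_at_right_less)

lemma nontrivial_base_step: "nhds x \<times>\<^sub>F at_right (0::real) \<noteq> bot"
  by (simp add: prod_filter_eq_bot)

lemma tendsto_step:
  fixes x d :: "'a::real_normed_vector"
  shows "((\<lambda>p. fst p + snd p *\<^sub>R d) \<longlongrightarrow> x) (nhds x \<times>\<^sub>F at_right (0::real))"
proof -
  have "((\<lambda>p. fst p + snd p *\<^sub>R d) \<longlongrightarrow> x + 0 *\<^sub>R d) (nhds x \<times>\<^sub>F at_right (0::real))"
    by (intro tendsto_intros tendsto_fst_nhds_at_right tendsto_snd_nhds_at_right)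
  then show ?thesis by simp
qed

lemma slope_le_mono: "slope_le g x d a" if "slope_le g x d b" "b \<le> a"
  using that(1) eventually_step_pos[of x] unfolding slope_le_def
proof eventually_elim
  case (elim p)
  then have "b * snd p \<le> a * snd p" using that(2) by (simp add: mult_right_mono)
  moreover have "g (fst p + snd p *\<^sub>R d) - g (fst p) \<le> b * snd p"
    using elim by (simp add: case_prod_beta)
  ultimately show ?case by (auto simp: case_prod_beta intro: order_trans simp del: mult_le_cancel_right)
qed

text \<open>
  Subadditivity. The two steps are taken one after the other; the second one starts from \<open>z + t e\<close>,
  which is harmless because the bound holds for all base points near \<open>x\<close>.
\<close>

lemma slope_le_add:
  assumes "slope_le g x d a" "slope_le g x e b"
  shows "slope_le g x (d + e) (a + b)"
proof -
  have "filterlim (\<lambda>p. (fst p + snd p *\<^sub>R e, snd p)) (nhds x \<times>\<^sub>F at_right (0::real))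
          (nhds x \<times>\<^sub>F at_right 0)"
    by (intro filterlim_Pair tendsto_step filterlim_snd)
  from eventually_compose_filterlim[OF assms(1)[unfolded slope_le_def] this]
  show ?thesis using assms(2) unfolding slope_le_def
    by eventually_elim (auto simp: algebra_simps case_prod_beta)
qed

lemma slope_le_scale:
  assumes "slope_le g x d a" "0 < s"
  shows "slope_le g x (s *\<^sub>R d) (s * a)"
proof -
  have 1: "filterlim (\<lambda>t. s * t) (at_right 0) (at_right (0::real))"
    unfolding filterlim_at using assms(2)
    by (auto intro!: tendsto_eq_intros eventually_at_right_less[THEN eventually_mono])
  have "filterlim (\<lambda>p. (fst p, s * snd p)) (nhds x \<times>\<^sub>F at_right (0::real))
          (nhds x \<times>\<^sub>F at_right 0)"
    by (intro filterlim_Pair filterlim_fst filterlim_compose[OF 1] filterlim_snd)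
  from eventually_compose_filterlim[OF assms(1)[unfolded slope_le_def] this]
  show ?thesis unfolding slope_le_def
    by eventually_elim (auto simp: algebra_simps case_prod_beta)
qed

lemma slope_le_lipschitz:
  assumes "L-lipschitz_on UNIV g"
  shows "slope_le g x d (L * norm d)"
  unfolding slope_le_def using eventually_step_pos[of x]
proof eventually_elim
  case (elim p)
  have "dist (g (fst p + snd p *\<^sub>R d)) (g (fst p)) \<le> L * dist (fst p + snd p *\<^sub>R d) (fst p)"
    by (rule lipschitz_onD[OF assms]) auto
  with elim show ?case by (auto simp: case_prod_beta dist_norm algebra_simps)
qed

lemma slope_le_zero_direction:
  assumes "slope_le g x 0 a" shows "0 \<le> a"
proof -
  have "\<forall>\<^sub>F p in nhds x \<times>\<^sub>F at_right (0::real). 0 \<le> a"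
    using assms eventually_step_pos[of x] unfolding slope_le_def
    by eventually_elim (auto simp: case_prod_beta zero_le_mult_iff)
  then show ?thesis using nontrivial_base_step[of x] by (simp add: eventually_const_iff)
qed

lemma slope_le_zero: "slope_le g x 0 0"
  by (simp add: slope_le_def split_def)

lemma slope_le_plus_scaled:
  assumes "slope_le g x d a" "slope_le h x d b" "0 \<le> c"
  shows "slope_le (\<lambda>z. g z + c * h z) x d (a + c * b)"
  using assms(1,2) unfolding slope_le_def
proof eventually_elim
  case (elim p)
  then have "c * (h (fst p + snd p *\<^sub>R d) - h (fst p)) \<le> c * (b * snd p)"
    using assms(3) by (auto intro!: mult_left_mono simp: case_prod_beta)
  with elim show ?case by (simp add: algebra_simps case_prod_beta)
qed

lemma slope_leD:
  assumes "slope_le g x d c"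
  obtains \<epsilon> where "0 < \<epsilon>"
    "\<And>z t. dist z x < \<epsilon> \<Longrightarrow> 0 < t \<Longrightarrow> t < \<epsilon> \<Longrightarrow> g (z + t *\<^sub>R d) - g z \<le> c * t"
proof -
  from assms obtain P Q where PQ: "eventually P (nhds x)" "eventually Q (at_right (0::real))"
    "\<And>z t. P z \<Longrightarrow> Q t \<Longrightarrow> g (z + t *\<^sub>R d) - g z \<le> c * t"
    unfolding slope_le_def eventually_prod_filter by (auto simp: case_prod_beta)
  from PQ(1) obtain e1 where e1: "0 < e1" "\<And>z. dist z x < e1 \<Longrightarrow> P z"
    unfolding eventually_nhds_metric by auto
  from PQ(2) obtain e2 where e2: "0 < e2" "\<And>t. 0 < t \<Longrightarrow> t < e2 \<Longrightarrow> Q t"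
    unfolding eventually_at_right_field by auto
  show thesis
    by (rule that[of "min e1 e2"]) (use e1 e2 PQ(3) in auto)
qed

text \<open>
  A slope bound is an open condition in the base point; this is the upper semicontinuity of the
  Clarke derivative, and it is what makes a compactness argument over base points possible.
\<close>

lemma slope_le_nhds:
  assumes "slope_le g x d c"
  shows "\<forall>\<^sub>F z in nhds x. slope_le g z d c"
proof -
  from assms obtain P Q where PQ: "eventually P (nhds x)" "eventually Q (at_right (0::real))"
    "\<And>z t. P z \<Longrightarrow> Q t \<Longrightarrow> g (z + t *\<^sub>R d) - g z \<le> c * t"
    unfolding slope_le_def eventually_prod_filter by (auto simp: case_prod_beta)
  from PQ(1) have "\<forall>\<^sub>F z in nhds x. eventually P (nhds z)"
    by (simp add: eventually_eventually)
  then show ?thesis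
    by eventually_elim (use PQ in \<open>auto simp: slope_le_def eventually_prod_filter\<close>)
qed

lemma slope_le_of_clarke_dderiv_less:
  assumes "clarke_dderiv g x d < ereal c"
  shows "slope_le g x d c"
proof -
  from Limsup_lessD[OF assms[unfolded clarke_dderiv_def]] eventually_step_pos[of x]
  show ?thesis unfolding slope_le_def
    by eventually_elim (auto simp: case_prod_beta field_simps)
qed

lemma clarke_dderiv_le_of_slope_le:
  assumes "slope_le g x d c"
  shows "clarke_dderiv g x d \<le> ereal c"
  unfolding clarke_dderiv_def
  by (rule Limsup_bounded)
     (use assms[unfolded slope_le_def] eventually_step_pos[of x] in
       \<open>eventually_elim, auto simp: case_prod_beta field_simps\<close>)

text \<open>
  A derivative of \<open>- \<infinity>\<close> along \<open>d\<close> would, added to the finite slope along \<open>- d\<close>, give a negative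
  slope along the zero direction.
\<close>

lemma clarke_dderiv_finite:
  assumes "L-lipschitz_on UNIV g"
  obtains p where "clarke_dderiv g x d = ereal p"
proof -
  have up: "clarke_dderiv g x d \<le> ereal (L * norm d)"
    by (intro clarke_dderiv_le_of_slope_le slope_le_lipschitz assms)
  have "clarke_dderiv g x d \<noteq> - \<infinity>"
  proof
    assume "clarke_dderiv g x d = - \<infinity>"
    then have "slope_le g x d (- L * norm d - 1)"
      by (intro slope_le_of_clarke_dderiv_less) auto
    from slope_le_add[OF this slope_le_lipschitz[OF assms, of x "- d"]]
    have "slope_le g x 0 (- 1)" by simp
    from slope_le_zero_direction[OF this] show False by simp
  qed
  with up that show thesis by (cases "clarke_dderiv g x d") auto
qed

text \<open>
  Hahn-Banach for the sublinear map \<open>d \<mapsto> g\<^sup>C\<^sup>l(x, d)\<close>. Its epigraph consists, up to closure, of the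
  pairs (direction, admissible slope); the line through \<open>(d, g\<^sup>C\<^sup>l(x, d))\<close>, pushed strictly downwards,
  misses it, and a separating hyperplane is the graph of the wanted subgradient.
\<close>

lemma clarke_subdiff_attains:
  fixes g :: "real^'n \<Rightarrow> real"
  assumes lip: "L-lipschitz_on UNIV g"
  shows "\<exists>\<xi>\<in>clarke_subdiff g x. ereal (\<xi> \<bullet> d) = clarke_dderiv g x d"
proof -
  obtain p where p: "clarke_dderiv g x d = ereal p" using clarke_dderiv_finite[OF lip] .
  have above_p: "slope_le g x d (p + e)" if "0 < e" for e
    using that p by (intro slope_le_of_clarke_dderiv_less) simp
  define E where "E = {(e, r). slope_le g x e r}"
  define T where "T = (\<lambda>(s, q). (s *\<^sub>R d, s * p - q)) ` (UNIV \<times> {0<..})"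
  have "convex E"
    unfolding convex_alt E_def
  proof (clarsimp)
    fix a r b r' and w :: real
    assume h: "slope_le g x a r" "slope_le g x b r'" "0 \<le> w" "w \<le> 1"
    consider "w = 0" | "w = 1" | "0 < w" "w < 1" using h by linarith
    then show "slope_le g x ((1 - w) *\<^sub>R a + w *\<^sub>R b) ((1 - w) * r + w * r')"
    proof cases
      case 3
      then show ?thesis by (intro slope_le_add slope_le_scale h) auto
    qed (use h in auto)
  qed
  moreover have "convex T"
    unfolding T_def
  proof -
    have "linear (\<lambda>(s, q). (s *\<^sub>R d, s * p - q))"
      by (rule linearI) (auto simp: algebra_simps)
    then show "convex ((\<lambda>(s, q). (s *\<^sub>R d, s * p - q)) ` (UNIV \<times> {0<..}))"
      by (intro convex_linear_image convex_Times) auto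
  qed
  moreover have "(0, 0) \<in> E" by (simp add: E_def slope_le_zero)
  moreover have "T \<noteq> {}" by (auto simp: T_def)
  moreover have "E \<inter> T = {}"
  proof (rule ccontr)
    assume "E \<inter> T \<noteq> {}"
    then obtain s q where sq: "0 < q" "slope_le g x (s *\<^sub>R d) (s * p - q)"
      by (auto simp: E_def T_def)
    consider "s = 0" | "0 < s" | "s < 0" by linarith
    then show False
    proof cases
      case 1
      with sq slope_le_zero_direction show False by fastforce
    next
      case 2
      from slope_le_scale[OF sq(2), of "1 / s"] 2
      have "slope_le g x d (p - q / s)" by (simp add: field_simps)
      from clarke_dderiv_le_of_slope_le[OF this] p 2 sq(1) show False
        by (simp add: divide_le_0_iff)
    next
      case 3
      have "slope_le g x ((- s) *\<^sub>R d) ((- s) * (p + q / (- 2 * s)))"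
        using 3 sq(1) by (intro slope_le_scale above_p) (auto simp: field_simps)
      from slope_le_add[OF sq(2) this] 3 have "slope_le g x 0 (- q / 2)"
        by (simp add: field_simps)
      from slope_le_zero_direction[OF this] sq(1) show False by simp
    qed
  qed
  ultimately obtain a b where ab: "a \<noteq> 0" "\<forall>z\<in>E. a \<bullet> z \<le> b" "\<forall>z\<in>T. b \<le> a \<bullet> z"
    using separating_hyperplane_sets[of E T] by blast
  obtain v w where a: "a = (v, w)" by (cases a)
  have onE: "v \<bullet> e + w * r \<le> b" if "slope_le g x e r" for e r
    using ab(2) that unfolding E_def a by (auto simp: inner_Pair)
  have onT: "b \<le> s * (v \<bullet> d + w * p) - w * q" if "0 < q" for s q
  proof -
    have "(s *\<^sub>R d, s * p - q) \<in> T" using that by (force simp: T_def)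
    with ab(3) have "b \<le> a \<bullet> (s *\<^sub>R d, s * p - q)" by blast
    then show ?thesis unfolding a by (simp add: inner_Pair algebra_simps)
  qed
  have b0: "0 \<le> b" using onE[OF slope_le_zero] by simp
  have w0: "w \<le> 0" using onT[of 1 0] b0 by simp
  have key: "v \<bullet> d + w * p = 0"
  proof (rule ccontr)
    assume ne: "v \<bullet> d + w * p \<noteq> 0"
    (* the bound on T is affine in s: choose s so that the first summand becomes w - 1 *)
    have "b \<le> (w - 1) / (v \<bullet> d + w * p) * (v \<bullet> d + w * p) - w * 1" by (rule onT) simp
    with ne b0 show False by simp
  qed
  have b_le: "b \<le> - w * q" if "0 < q" for q using onT[OF that, of 0] by simp
  have b: "b = 0"
  proof (rule ccontr)
    assume "b \<noteq> 0"
    with b0 have "0 < b" by simp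
    with b_le[of 1] have "w < 0" by simp
    with b_le[of "b / (- 2 * w)"] \<open>0 < b\<close> show False by (simp add: field_simps)
  qed
  have w: "w < 0"
  proof (rule ccontr)
    assume "\<not> w < 0"
    with w0 have "w = 0" by simp
    with onE[OF slope_le_lipschitz[OF lip, of x v]] b have "v \<bullet> v \<le> 0" by simp
    then have "v = 0" using inner_gt_zero_iff[of v] by linarith
    with \<open>w = 0\<close> a ab(1) show False by (simp add: zero_prod_def)
  qed
  define \<xi> where "\<xi> = (1 / (- w)) *\<^sub>R v"
  have sub: "\<xi> \<bullet> e \<le> r" if "slope_le g x e r" for e r
    using onE[OF that] b w by (simp add: \<xi>_def field_simps)
  have "\<xi> \<bullet> d = p" using key w by (simp add: \<xi>_def field_simps)
  moreover have "\<xi> \<in> clarke_subdiff g x"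
    unfolding clarke_subdiff_def
  proof (clarify, rule ccontr)
    fix e assume "\<not> ereal (\<xi> \<bullet> e) \<le> clarke_dderiv g x e"
    then obtain c where "clarke_dderiv g x e < ereal c" "c < \<xi> \<bullet> e"
      using ereal_dense2[of "clarke_dderiv g x e" "ereal (\<xi> \<bullet> e)"] by (auto simp: not_le)
    with sub[OF slope_le_of_clarke_dderiv_less] show False by force
  qed
  ultimately show ?thesis using p by auto
qed

section \<open>The exact penalty\<close>

text \<open>The penalty term; including \<open>0\<close> in the maximum makes it vanish exactly on the feasible set.\<close>

definition violation :: "real^'m \<Rightarrow> real" where
  "violation v = Max (insert 0 (range (\<lambda>i. v $ i)))"

lemma violation_le_iff: "violation v \<le> b \<longleftrightarrow> 0 \<le> b \<and> (\<forall>i. v $ i \<le> b)"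
  by (simp add: violation_def)

lemma violation_nonneg: "0 \<le> violation v"
  and component_le_violation: "v $ i \<le> violation v"
  using violation_le_iff[of v "violation v"] by auto

lemma violation_eq_0: "(\<And>i. v $ i \<le> 0) \<Longrightarrow> violation v = 0"
  using violation_le_iff[of v 0] violation_nonneg[of v] by auto

lemma violation_diff_le:
  fixes v w b :: "real^'m"
  assumes "\<And>i. \<bar>v $ i - w $ i\<bar> \<le> b $ i"
  shows "\<bar>violation v - violation w\<bar> \<le> (\<Sum>i\<in>UNIV. b $ i)"
proof -
  have b: "0 \<le> b $ i" for i using assms[of i] by linarith
  have b_le: "b $ i \<le> (\<Sum>i\<in>UNIV. b $ i)" for i
    by (rule member_le_sum) (use b in auto)
  have 1: "violation v' \<le> violation w' + (\<Sum>i\<in>UNIV. b $ i)"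
    if "\<And>i. \<bar>v' $ i - w' $ i\<bar> \<le> b $ i" for v' w' :: "real^'m"
    unfolding violation_le_iff
  proof (intro conjI allI)
    show "0 \<le> violation w' + (\<Sum>i\<in>UNIV. b $ i)"
      using b violation_nonneg[of w'] by (simp add: sum_nonneg)
    fix i
    show "v' $ i \<le> violation w' + (\<Sum>i\<in>UNIV. b $ i)"
      using that[of i] b_le[of i] component_le_violation[of w' i] by linarith
  qed
  from 1[OF assms] 1[of w v] assms show ?thesis by (simp add: abs_minus_commute abs_le_iff)
qed

lemma violation_lipschitz:
  fixes h :: "real^'n \<Rightarrow> real^'m"
  assumes "\<And>i. (L $ i)-lipschitz_on UNIV (\<lambda>x. h x $ i)"
  shows "(\<Sum>i\<in>UNIV. L $ i)-lipschitz_on UNIV (\<lambda>x. violation (h x))"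
proof (rule lipschitz_onI)
  show "0 \<le> (\<Sum>i\<in>UNIV. L $ i)"
    by (intro sum_nonneg) (use assms lipschitz_on_nonneg in blast)
  fix x x'
  have "\<bar>violation (h x) - violation (h x')\<bar> \<le> (\<Sum>i\<in>UNIV. (\<chi> i. L $ i * dist x x') $ i)"
    by (rule violation_diff_le) (use lipschitz_onD[OF assms] in \<open>auto simp: dist_real_def\<close>)
  then show "dist (violation (h x)) (violation (h x')) \<le> (\<Sum>i\<in>UNIV. L $ i) * dist x x'"
    by (simp add: dist_real_def sum_distrib_right)
qed

lemma penalty_lipschitz:
  fixes h :: "real^'n \<Rightarrow> real^'m"
  assumes "LF-lipschitz_on UNIV f" "\<And>i. (L $ i)-lipschitz_on UNIV (\<lambda>x. h x $ i)" "0 < \<rho>"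
  shows "(LF + 1 / \<rho> * (\<Sum>i\<in>UNIV. L $ i))-lipschitz_on UNIV
           (\<lambda>x. f x + 1 / \<rho> * violation (h x))"
  using lipschitz_on_add[OF assms(1) lipschitz_on_cmult[OF violation_lipschitz[OF assms(2)]], of "1 / \<rho>"]
    assms(3) by simp

text \<open>
  Only the terms attaining the maximum matter for its slope: a component below \<open>violation (h x)\<close>
  stays below it at all nearby points, and so does the constant \<open>0\<close> at an infeasible point.
\<close>

lemma slope_le_violation:
  fixes h :: "real^'n \<Rightarrow> real^'m"
  assumes lip: "\<And>i. (L $ i)-lipschitz_on UNIV (\<lambda>x. h x $ i)"
    and comp: "\<And>i. slope_le (\<lambda>x. h x $ i) x d b \<or> h x $ i < violation (h x)"
    and zero: "0 \<le> b \<or> 0 < violation (h x)"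
  shows "slope_le (\<lambda>x. violation (h x)) x d b"
proof -
  let ?F = "nhds x \<times>\<^sub>F at_right (0::real)"
  have cont: "((\<lambda>p. g (c p)) \<longlongrightarrow> g x) ?F"
    if "K-lipschitz_on UNIV g" "(c \<longlongrightarrow> x) ?F" for g :: "real^'n \<Rightarrow> real" and K c
    using lipschitz_on_continuous_on[OF that(1)] that(2)
    by (auto simp: continuous_on_eq_continuous_at isCont_def intro: isCont_tendsto_compose)
  have lim: "((\<lambda>p. violation (h (fst p)) + b * snd p) \<longlongrightarrow> violation (h x) + b * 0) ?F"
    by (intro tendsto_intros tendsto_snd_nhds_at_right cont[OF violation_lipschitz[OF lip]]
        tendsto_fst_nhds_at_right)
  have "\<forall>\<^sub>F p in ?F. h (fst p + snd p *\<^sub>R d) $ i \<le> violation (h (fst p)) + b * snd p" for i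
  proof (cases "h x $ i < violation (h x)")
    case True
    from order_tendstoD(2)[OF tendsto_diff[OF cont[OF lip[of i] tendsto_step[of d x]] lim], of 0] True
    show ?thesis by (auto elim!: eventually_mono)
  next
    case False
    with comp have "slope_le (\<lambda>x. h x $ i) x d b" by blast
    then show ?thesis unfolding slope_le_def
      by eventually_elim
        (use component_le_violation in \<open>force simp: case_prod_beta algebra_simps intro: order_trans\<close>)
  qed
  then have "\<forall>\<^sub>F p in ?F. \<forall>i. h (fst p + snd p *\<^sub>R d) $ i \<le> violation (h (fst p)) + b * snd p"
    by (intro eventually_all_finite) auto
  moreover have "\<forall>\<^sub>F p in ?F. 0 \<le> violation (h (fst p)) + b * snd p"
  proof (cases "0 \<le> b")
    case True
    show ?thesis using eventually_step_pos[of x]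
      by eventually_elim (use True violation_nonneg in \<open>auto intro!: add_nonneg_nonneg\<close>)
  next
    case False
    with zero have "0 < violation (h x) + b * 0" by simp
    from order_tendstoD(1)[OF lim this] show ?thesis by eventually_elim simp
  qed
  ultimately show ?thesis unfolding slope_le_def
    by eventually_elim (auto simp: case_prod_beta violation_le_iff diff_le_eq add.commute)
qed

text \<open>
  At a feasible point the penalty grows too slowly to cancel the gain \<open>- r\<close> of the objective if
  every active constraint grows more slowly than \<open>- \<rho> * r\<close>. The positive part \<open>violation s\<close> of the largest
  constraint slope serves as slope of the penalty term.
\<close>

lemma penalty_descends_at_feasible:
  fixes f :: "real^'n \<Rightarrow> real" and h :: "real^'n \<Rightarrow> real^'m"
  assumes lip: "\<And>i. (L $ i)-lipschitz_on UNIV (\<lambda>x. h x $ i)"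
    and feas: "\<And>i. h x $ i \<le> 0" and "0 < \<rho>"
    and f: "slope_le f x d r" "r < 0"
    and h: "\<And>i. h x $ i = 0 \<Longrightarrow> slope_le (\<lambda>x. h x $ i) x d (s $ i)"
    and s: "\<And>i. \<rho> * r + s $ i < 0"
  shows "\<exists>a<0. slope_le (\<lambda>x. f x + 1 / \<rho> * violation (h x)) x d a"
proof (intro exI conjI)
  have v0: "violation (h x) = 0" by (rule violation_eq_0) (rule feas)
  show "slope_le (\<lambda>x. f x + 1 / \<rho> * violation (h x)) x d (r + 1 / \<rho> * violation s)"
  proof (intro slope_le_plus_scaled f slope_le_violation[OF lip])
    fix i
    show "slope_le (\<lambda>x. h x $ i) x d (violation s) \<or> h x $ i < violation (h x)"
    proof (cases "h x $ i = 0")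
      case True
      from slope_le_mono[OF h[OF this] component_le_violation] show ?thesis ..
    qed (use feas[of i] v0 in auto)
  qed (use \<open>0 < \<rho>\<close> violation_nonneg in auto)
  have "\<not> - (\<rho> * r) \<le> violation s"
  proof -
    have "violation s \<in> insert 0 (range (\<lambda>i. s $ i))"
      unfolding violation_def by (rule Max_in) auto
    moreover have "\<rho> * r < 0" using \<open>0 < \<rho>\<close> \<open>r < 0\<close> by (simp add: mult_pos_neg)
    moreover have "s $ i < - (\<rho> * r)" for i using s[of i] by linarith
    ultimately show ?thesis by (auto simp: not_le)
  qed
  then show "r + 1 / \<rho> * violation s < 0" using \<open>0 < \<rho>\<close> by (simp add: field_simps)
qed

text \<open>Moving a little can free a bound but cannot make an inactive one active.\<close>

lemma feasible_cone_nhds: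
  fixes l u x d :: "real^'n"
  assumes "d \<in> feasible_cone l u x"
  shows "\<forall>\<^sub>F z in nhds x. d \<in> feasible_cone l u z"
proof -
  have "\<forall>\<^sub>F z in nhds x. (z $ i = c \<longrightarrow> x $ i = c)" for i c
  proof (cases "x $ i = c")
    case False
    have "((\<lambda>z. z $ i) \<longlongrightarrow> x $ i) (nhds x)" by (intro tendsto_intros filterlim_ident)
    from tendsto_imp_eventually_ne[OF this False] show ?thesis by eventually_elim simp
  qed simp
  then have "\<forall>\<^sub>F z in nhds x. \<forall>i. (z $ i = l $ i \<longrightarrow> x $ i = l $ i) \<and> (z $ i = u $ i \<longrightarrow> x $ i = u $ i)"
    by (intro eventually_all_finite eventually_conj) auto
  then show ?thesis by eventually_elim (use assms in \<open>auto simp: feasible_cone_def\<close>)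
qed

text \<open>
  The qualification condition at \<open>x\<close> gives a direction along which all constraints with
  \<open>0 \<le> h x $ i\<close> decrease at a common rate \<open>c\<close>; subgradients enter only here, and attainment of the
  Clarke derivative turns their sign condition into a slope. The same direction and rate serve at
  all nearby infeasible points, where the penalty then falls at the rate \<open>c / \<rho>\<close> and outweighs the
  objective, which rises at most at the rate \<open>LF * norm d\<close>.
\<close>

lemma penalty_descends_near:
  fixes f :: "real^'n \<Rightarrow> real" and h :: "real^'n \<Rightarrow> real^'m"
  assumes emfcq: "EMFCQ l u h"
    and lip_f: "LF-lipschitz_on UNIV f"
    and lip: "\<And>i. (L $ i)-lipschitz_on UNIV (\<lambda>x. h x $ i)"
    and x: "x \<in> cbox l u - interior {x. \<forall>i. h x $ i \<le> 0}"
  shows "\<exists>\<rho>0>0. \<forall>\<^sub>F z in nhds x. \<not> (\<forall>i. h z $ i \<le> 0) \<longrightarrow>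
           (\<forall>\<rho>\<in>{0<..\<rho>0}. \<exists>d\<in>feasible_cone l u z. \<exists>a<0.
              slope_le (\<lambda>x. f x + 1 / \<rho> * violation (h x)) z d a)"
proof -
  from emfcq x obtain d where d: "d \<in> feasible_cone l u x"
    "\<And>i \<xi>. 0 \<le> h x $ i \<Longrightarrow> \<xi> \<in> clarke_subdiff (\<lambda>x. h x $ i) x \<Longrightarrow> \<xi> \<bullet> d < 0"
    unfolding EMFCQ_def by blast
  have "\<forall>\<^sub>F c in at_right 0. 0 \<le> h x $ i \<longrightarrow> slope_le (\<lambda>x. h x $ i) x d (- c)" for i
  proof (cases "0 \<le> h x $ i")
    case True
    from clarke_subdiff_attains[OF lip] obtain \<xi> where
      \<xi>: "\<xi> \<in> clarke_subdiff (\<lambda>x. h x $ i) x"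
         "ereal (\<xi> \<bullet> d) = clarke_dderiv (\<lambda>x. h x $ i) x d" by blast
    have "\<forall>\<^sub>F c in at_right 0. c < - (\<xi> \<bullet> d)"
      using d(2)[OF True \<xi>(1)] by (intro eventually_at_right_real[THEN eventually_mono]) auto
    then show ?thesis
      by eventually_elim (auto intro!: slope_le_of_clarke_dderiv_less simp: \<xi>(2)[symmetric])
  qed simp
  then have "\<forall>\<^sub>F c in at_right 0. \<forall>i. 0 \<le> h x $ i \<longrightarrow> slope_le (\<lambda>x. h x $ i) x d (- c)"
    by (intro eventually_all_finite) auto
  with eventually_at_right_less
  have "\<forall>\<^sub>F c in at_right (0::real).
      0 < c \<and> (\<forall>i. 0 \<le> h x $ i \<longrightarrow> slope_le (\<lambda>x. h x $ i) x d (- c))"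
    by (rule eventually_conj)
  from eventually_happens'[OF _ this] obtain c where c: "0 < c"
    "\<And>i. 0 \<le> h x $ i \<Longrightarrow> slope_le (\<lambda>x. h x $ i) x d (- c)" by auto
  (* the summand 1 makes the comparison strict and keeps the denominator positive if LF = 0 *)
  define \<rho>0 where "\<rho>0 = c / (LF * norm d + 1)"
  have LF: "0 \<le> LF * norm d" using lipschitz_on_nonneg[OF lip_f] by simp
  have "\<forall>\<^sub>F z in nhds x. slope_le (\<lambda>x. h x $ i) z d (- c) \<or> h z $ i < 0" for i
  proof (cases "0 \<le> h x $ i")
    case True
    from slope_le_nhds[OF c(2)[OF this]] show ?thesis by eventually_elim simp
  next
    case False
    have "isCont (\<lambda>x. h x $ i) x"
      using lipschitz_on_continuous_on[OF lip] by (auto simp: continuous_on_eq_continuous_at)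
    then have "((\<lambda>x. h x $ i) \<longlongrightarrow> h x $ i) (nhds x)" by (simp add: isCont_def tendsto_nhds_iff)
    from order_tendstoD(2)[OF this, of 0] False show ?thesis
      by (auto elim: eventually_mono)
  qed
  then have "\<forall>\<^sub>F z in nhds x. \<forall>i. slope_le (\<lambda>x. h x $ i) z d (- c) \<or> h z $ i < 0"
    by (intro eventually_all_finite) auto
  with feasible_cone_nhds[OF d(1)]
  have "\<forall>\<^sub>F z in nhds x. \<not> (\<forall>i. h z $ i \<le> 0) \<longrightarrow>
           (\<forall>\<rho>\<in>{0<..\<rho>0}. \<exists>d\<in>feasible_cone l u z. \<exists>a<0.
              slope_le (\<lambda>x. f x + 1 / \<rho> * violation (h x)) z d a)"
  proof eventually_elim
    case (elim z)
    show ?case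
    proof (intro impI ballI bexI[OF _ elim(1)])
      fix \<rho> assume infeas: "\<not> (\<forall>i. h z $ i \<le> 0)" and \<rho>: "\<rho> \<in> {0<..\<rho>0}"
      have pos: "0 < violation (h z)"
        using infeas component_le_violation[of "h z"] by (meson not_le order_less_le_trans)
      have "slope_le (\<lambda>x. violation (h x)) z d (- c)"
        by (rule slope_le_violation[OF lip]) (use elim(2) pos in \<open>auto intro: less_trans\<close>)
      with slope_le_lipschitz[OF lip_f]
      have "slope_le (\<lambda>x. f x + 1 / \<rho> * violation (h x)) z d (LF * norm d + 1 / \<rho> * - c)"
        by (intro slope_le_plus_scaled) (use \<rho> in auto)
      moreover have "LF * norm d + 1 / \<rho> * - c < 0"
      proof -
        have "\<rho> * (LF * norm d + 1) \<le> c"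
          using \<rho> LF by (simp add: \<rho>0_def field_simps)
        then have "\<rho> * (LF * norm d) < c" using \<rho> by (simp add: algebra_simps)
        then show ?thesis using \<rho> by (simp add: field_simps)
      qed
      ultimately show "\<exists>a<0. slope_le (\<lambda>x. f x + 1 / \<rho> * violation (h x)) z d a" by blast
    qed
  qed
  moreover have "0 < \<rho>0" using c(1) LF by (simp add: \<rho>0_def)
  ultimately show ?thesis by blast
qed

text \<open>
  The threshold. Infeasible points may accumulate at the boundary of the feasible set; the
  qualification condition holds there as well, so the local thresholds of
  \<open>penalty_descends_near\<close> cover a compact set and have a positive minimum.
\<close>

lemma penalty_threshold:
  fixes f :: "real^'n \<Rightarrow> real" and h :: "real^'n \<Rightarrow> real^'m"
  assumes emfcq: "EMFCQ l u h"
    and lip_f: "LF-lipschitz_on UNIV f"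
    and lip: "\<And>i. (L $ i)-lipschitz_on UNIV (\<lambda>x. h x $ i)"
  obtains \<rho>max where "0 < \<rho>max"
    "\<And>\<rho> x. \<rho> \<in> {0<..\<rho>max} \<Longrightarrow> x \<in> cbox l u \<Longrightarrow> \<not> (\<forall>i. h x $ i \<le> 0) \<Longrightarrow>
       \<exists>d\<in>feasible_cone l u x. \<exists>a<0. slope_le (\<lambda>x. f x + 1 / \<rho> * violation (h x)) x d a"
proof -
  let ?V = "cbox l u - interior {x. \<forall>i. h x $ i \<le> 0}"
  let ?Q = "\<lambda>\<rho>0 z. \<not> (\<forall>i. h z $ i \<le> 0) \<longrightarrow>
           (\<forall>\<rho>\<in>{0<..\<rho>0}. \<exists>d\<in>feasible_cone l u z. \<exists>a<0.
              slope_le (\<lambda>x. f x + 1 / \<rho> * violation (h x)) z d a)"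
  define Q where "Q = ?Q"
  have "\<exists>\<rho>0 U. 0 < \<rho>0 \<and> open U \<and> x \<in> U \<and> (\<forall>z\<in>U. Q \<rho>0 z)" if "x \<in> ?V" for x
  proof -
    have "\<exists>\<rho>0>0. \<forall>\<^sub>F z in nhds x. Q \<rho>0 z"
      unfolding Q_def using penalty_descends_near[OF emfcq lip_f lip that] .
    then show ?thesis unfolding eventually_nhds by blast
  qed
  then obtain \<rho>0 U where
    U: "\<And>x. x \<in> ?V \<Longrightarrow> 0 < \<rho>0 x \<and> open (U x) \<and> x \<in> U x \<and> (\<forall>z\<in>U x. Q (\<rho>0 x) z)"
    by metis
  have "compact ?V" by (intro compact_diff compact_cbox open_interior)
  then obtain C where C: "C \<subseteq> ?V" "finite C" "?V \<subseteq> (\<Union>x\<in>C. U x)"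
    by (rule compactE_image[of ?V ?V U]) (use U in blast)+
  define \<rho>max where "\<rho>max = Min (insert 1 (\<rho>0 ` C))"
  show thesis
  proof
    show "0 < \<rho>max" using C U by (auto simp: \<rho>max_def subset_iff)
    fix \<rho> x assume h: "\<rho> \<in> {0<..\<rho>max}" "x \<in> cbox l u" "\<not> (\<forall>i. h x $ i \<le> 0)"
    from h(3) have "x \<notin> interior {x. \<forall>i. h x $ i \<le> 0}" using interior_subset by blast
    with h(2) C obtain w where w: "w \<in> C" "x \<in> U w" by blast
    then have "\<rho>max \<le> \<rho>0 w" using C by (auto simp: \<rho>max_def)
    with h(1) have "\<rho> \<in> {0<..\<rho>0 w}" by simp
    moreover have "Q (\<rho>0 w) x" using U[of w] w C(1) by blast
    ultimately
    show "\<exists>d\<in>feasible_cone l u x. \<exists>a<0. slope_le (\<lambda>x. f x + 1 / \<rho> * violation (h x)) x d a"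
      using h(3) unfolding Q_def by blast
  qed
qed

section \<open>Multipliers\<close>

lemma feasible_cone_zero: "0 \<in> feasible_cone l u x"
  by (simp add: feasible_cone_def)

lemma feasible_cone_scale: "d \<in> feasible_cone l u x \<Longrightarrow> 0 \<le> s \<Longrightarrow> s *\<^sub>R d \<in> feasible_cone l u x"
  by (auto simp: feasible_cone_def mult_nonneg_nonpos)

lemma feasible_cone_add:
  "d \<in> feasible_cone l u x \<Longrightarrow> e \<in> feasible_cone l u x \<Longrightarrow> d + e \<in> feasible_cone l u x"
  by (simp add: feasible_cone_def add_nonpos_nonpos)

text \<open>
  A theorem of the alternative. The attainable slope vectors \<open>(r, s)\<close> form a convex cone \<open>C\<close> that is
  closed under increasing entries, and \<open>T\<close> collects the slope vectors for which objective plus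
  penalty decreases. A separating functional of the two has nonnegative coefficients because of
  the shape of \<open>C\<close>. Its objective coefficient is positive because \<open>T\<close> contains points with arbitrary
  \<open>s\<close> as soon as \<open>r\<close> is negative enough, so it can be normalised to 1. This is where the penalty
  takes the role of a constraint qualification: with the weaker requirement that all slopes be
  negative one would only get multipliers of Fritz John type.
\<close>

lemma multipliers_of_inconsistent_slopes:
  fixes f :: "real^'n \<Rightarrow> real" and h :: "real^'n \<Rightarrow> real^'m"
  assumes "0 < \<rho>"
    and incons: "\<not> (\<exists>d\<in>feasible_cone l u x. \<exists>r s. slope_le f x d r \<and> r < 0 \<and>
      (\<forall>i\<in>I. slope_le (\<lambda>x. h x $ i) x d (s $ i)) \<and> (\<forall>i. \<rho> * r + s $ i < 0))"
  shows "\<exists>mult :: real^'m. (\<forall>i. 0 \<le> mult $ i) \<and> (\<forall>i. i \<notin> I \<longrightarrow> mult $ i = 0) \<and>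
    (\<forall>d\<in>feasible_cone l u x. \<forall>r s. slope_le f x d r \<longrightarrow>
      (\<forall>i\<in>I. slope_le (\<lambda>x. h x $ i) x d (s $ i)) \<longrightarrow> 0 \<le> r + mult \<bullet> s)"
proof -
  define C where "C = {z :: real \<times> (real^'m). \<exists>d\<in>feasible_cone l u x. slope_le f x d (fst z) \<and>
      (\<forall>i\<in>I. slope_le (\<lambda>x. h x $ i) x d (snd z $ i))}"
  define T where "T = {(r, s :: real^'m). r < 0 \<and> (\<forall>i. \<rho> * r + s $ i < 0)}"
  have C_add: "z + w \<in> C" if "z \<in> C" "w \<in> C" for z w
  proof -
    from that(1) obtain d where
      "d \<in> feasible_cone l u x" "slope_le f x d (fst z)"
      "\<forall>i\<in>I. slope_le (\<lambda>x. h x $ i) x d (snd z $ i)"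
      unfolding C_def by blast
    moreover from that(2) obtain e where
      "e \<in> feasible_cone l u x" "slope_le f x e (fst w)"
      "\<forall>i\<in>I. slope_le (\<lambda>x. h x $ i) x e (snd w $ i)"
      unfolding C_def by blast
    ultimately show ?thesis unfolding C_def
      by (intro CollectI bexI[of _ "d + e"]) (auto intro: slope_le_add feasible_cone_add)
  qed
  have C_scale: "k *\<^sub>R z \<in> C" if "z \<in> C" "0 < k" for z and k :: real
  proof -
    from that(1) obtain d where
      "d \<in> feasible_cone l u x" "slope_le f x d (fst z)"
      "\<forall>i\<in>I. slope_le (\<lambda>x. h x $ i) x d (snd z $ i)"
      unfolding C_def by blast
    with \<open>0 < k\<close> show ?thesis unfolding C_def
      by (intro CollectI bexI[of _ "k *\<^sub>R d"])
        (auto intro: slope_le_scale[of _ _ _ _ k, simplified] feasible_cone_scale)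
  qed
  have CI: "(r, s) \<in> C" if "0 \<le> r" "\<And>i. i \<in> I \<Longrightarrow> 0 \<le> s $ i" for r s
    unfolding C_def using that
    by (auto intro!: bexI[of _ 0] feasible_cone_zero intro: slope_le_mono[OF slope_le_zero])
  have "convex C"
    unfolding convex_alt
  proof (intro ballI allI impI)
    fix z w and v :: real
    assume h: "z \<in> C" "w \<in> C" "0 \<le> v \<and> v \<le> 1"
    consider "v = 0" | "v = 1" | "0 < v" "v < 1" using h by linarith
    then show "(1 - v) *\<^sub>R z + v *\<^sub>R w \<in> C"
      by cases (use h C_add C_scale in auto)
  qed
  moreover have "convex T"
  proof -
    have "T = {z. inner (1, 0) z < 0} \<inter> (\<Inter>i. {z. inner (\<rho>, axis i 1) z < 0})"
      by (auto simp: T_def inner_Pair inner_axis')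
    then show ?thesis by (simp add: convex_halfspace_lt convex_Int convex_INT)
  qed
  moreover have "(0, 0) \<in> C" by (rule CI) auto
  moreover have "(- 1, 0) \<in> T" using \<open>0 < \<rho>\<close> by (simp add: T_def)
  moreover have "T \<inter> C = {}"
  proof (rule ccontr)
    assume "T \<inter> C \<noteq> {}"
    then obtain d r s where "d \<in> feasible_cone l u x" "slope_le f x d r" "r < 0"
      "\<forall>i\<in>I. slope_le (\<lambda>x. h x $ i) x d (s $ i)" "\<forall>i. \<rho> * r + s $ i < 0"
      by (auto simp: C_def T_def)
    with incons show False by blast
  qed
  ultimately obtain a b where ab: "a \<noteq> 0" "\<forall>z\<in>T. a \<bullet> z \<le> b" "\<forall>z\<in>C. b \<le> a \<bullet> z"
    using separating_hyperplane_sets[of T C] by blast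
  obtain a0 v where a: "a = (a0, v)" by (cases a)
  have onT: "a0 * r + v \<bullet> s \<le> b" if "r < 0" "\<And>i. \<rho> * r + s $ i < 0" for r s
    using ab(2) that unfolding a T_def by (auto simp: inner_Pair)
  have onC: "b \<le> a0 * r + v \<bullet> s" if "(r, s) \<in> C" for r s
    using ab(3) that unfolding a by (auto simp: inner_Pair)
  have "b \<le> 0" using onC[OF CI[of 0 0]] by simp
  have b_ge: "- (k * a0) \<le> b" if "0 < k" for k
    using onT[of "- k" 0] that \<open>0 < \<rho>\<close> by (simp add: mult.commute)
  have C_nonneg: "0 \<le> a0 * r + v \<bullet> s" if "(r, s) \<in> C" for r s
  proof (rule ccontr)
    let ?q = "a0 * r + v \<bullet> s"
    assume neg: "\<not> 0 \<le> ?q"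
    (* C is a cone: scaling the point by k moves its value to b - 1, below the bound b. *)
    define k where "k = (b - 1) / ?q"
    have "0 < k" using neg \<open>b \<le> 0\<close> by (auto simp: k_def intro!: divide_neg_neg)
    from C_scale[OF that this] have "(k * r, k *\<^sub>R s) \<in> C" by simp
    from onC[OF this] have "b \<le> k * ?q" by (simp add: algebra_simps)
    also have "\<dots> = b - 1" using neg by (simp add: k_def)
    finally show False by simp
  qed
  have b0: "b = 0"
  proof (rule ccontr)
    assume "b \<noteq> 0"
    with \<open>b \<le> 0\<close> have "b < 0" by simp
    with b_ge[of 1] have "0 < a0" by simp
    with b_ge[of "- b / (2 * a0)"] \<open>b < 0\<close> show False by (simp add: field_simps)
  qed
  have v_nonneg: "0 \<le> v $ i" for i
  proof -
    have "0 \<le> v \<bullet> axis i 1" using C_nonneg[OF CI[of 0 "axis i 1"]] by (auto simp: axis_def)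
    then show ?thesis by (simp add: inner_axis)
  qed
  have v_off: "v $ i = 0" if "i \<notin> I" for i
  proof -
    have "(0, axis i (- 1)) \<in> C" using that by (intro CI) (auto simp: axis_def)
    from C_nonneg[OF this] have "0 \<le> v \<bullet> axis i (- 1)" by simp
    with v_nonneg[of i] show ?thesis by (simp add: inner_axis)
  qed
  have a0: "0 < a0"
  proof (rule ccontr)
    assume "\<not> 0 < a0"
    moreover have "0 \<le> a0" using C_nonneg[OF CI[of 1 0]] by simp
    ultimately have "a0 = 0" by simp
    (* negative enough for the point (r, v) to lie in T; without an objective coefficient the
       functional takes the value v \<bullet> v there *)
    define r where "r = - (1 + norm v) / \<rho>"
    have "\<rho> * r + v $ i < 0" for i
      using component_le_norm_cart[of v i] \<open>0 < \<rho>\<close> by (simp add: r_def)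
    moreover have "r < 0"
      using \<open>0 < \<rho>\<close> norm_ge_zero[of v] unfolding r_def by (intro divide_neg_pos) linarith+
    ultimately have "a0 * r + v \<bullet> v \<le> b" by (intro onT)
    with \<open>a0 = 0\<close> b0 have "v \<bullet> v \<le> 0" by simp
    then have "v = 0" using inner_gt_zero_iff[of v] by linarith
    with \<open>a0 = 0\<close> a ab(1) show False by (simp add: zero_prod_def)
  qed
  show ?thesis
  proof (intro exI[of _ "(1 / a0) *\<^sub>R v"] conjI ballI allI impI)
    fix d r s
    assume "d \<in> feasible_cone l u x" "slope_le f x d r"
      "\<forall>i\<in>I. slope_le (\<lambda>x. h x $ i) x d (s $ i)"
    then have "(r, s) \<in> C" unfolding C_def by auto
    from C_nonneg[OF this] a0 show "0 \<le> r + ((1 / a0) *\<^sub>R v) \<bullet> s"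
      by (simp add: field_simps)
  qed (use v_nonneg v_off a0 in auto)
qed

text \<open>
  For a fixed direction \<open>d\<close> the maximum over the sum of subdifferentials splits, since the
  subgradients of the summands can be chosen independently: it is the weighted sum of the Clarke
  derivatives in direction \<open>d\<close>, attained by combining maximisers, and the multipliers were chosen
  to make this sum nonnegative. As only slopes strictly above the Clarke derivatives are known to be
  attainable, the last inequality is reached through an \<open>\<epsilon>\<close>.
\<close>

lemma clarke_KKT_of_no_penalty_descent:
  fixes f :: "real^'n \<Rightarrow> real" and h :: "real^'n \<Rightarrow> real^'m"
  assumes lip_f: "LF-lipschitz_on UNIV f"
    and lip: "\<And>i. (L $ i)-lipschitz_on UNIV (\<lambda>x. h x $ i)"
    and "0 < \<rho>" and x: "x \<in> cbox l u" and feas: "\<And>i. h x $ i \<le> 0"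
    and no_descent: "\<And>d a. d \<in> feasible_cone l u x \<Longrightarrow> a < 0 \<Longrightarrow>
      \<not> slope_le (\<lambda>x. f x + 1 / \<rho> * violation (h x)) x d a"
  shows "clarke_KKT l u f h x"
proof -
  define I where "I = {i. h x $ i = 0}"
  have incons: "\<not> (\<exists>d\<in>feasible_cone l u x. \<exists>r s. slope_le f x d r \<and> r < 0 \<and>
      (\<forall>i\<in>I. slope_le (\<lambda>x. h x $ i) x d (s $ i)) \<and> (\<forall>i. \<rho> * r + s $ i < 0))"
  proof clarify
    fix d r and s :: "real^'m"
    assume d: "d \<in> feasible_cone l u x" and f: "slope_le f x d r" "r < 0"
      and "\<forall>i\<in>I. slope_le (\<lambda>x. h x $ i) x d (s $ i)" "\<forall>i. \<rho> * r + s $ i < 0"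
    then have "\<exists>a<0. slope_le (\<lambda>x. f x + 1 / \<rho> * violation (h x)) x d a"
      by (intro penalty_descends_at_feasible[OF lip feas \<open>0 < \<rho>\<close> f, of s]) (auto simp: I_def)
    with no_descent d show False by blast
  qed
  obtain mult :: "real^'m" where mult: "\<And>i. 0 \<le> mult $ i" "\<And>i. i \<notin> I \<Longrightarrow> mult $ i = 0"
    "\<And>d r s. d \<in> feasible_cone l u x \<Longrightarrow> slope_le f x d r \<Longrightarrow>
      (\<And>i. i \<in> I \<Longrightarrow> slope_le (\<lambda>x. h x $ i) x d (s $ i)) \<Longrightarrow> 0 \<le> r + mult \<bullet> s"
  proof -
    from multipliers_of_inconsistent_slopes[OF \<open>0 < \<rho>\<close> incons] obtain mult :: "real^'m" where
      "\<forall>i. 0 \<le> mult $ i" "\<forall>i. i \<notin> I \<longrightarrow> mult $ i = 0"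
      "\<forall>d\<in>feasible_cone l u x. \<forall>r s. slope_le f x d r \<longrightarrow>
        (\<forall>i\<in>I. slope_le (\<lambda>x. h x $ i) x d (s $ i)) \<longrightarrow> 0 \<le> r + mult \<bullet> s"
      by (elim exE conjE)
    then show thesis by (intro that[of mult]) simp_all
  qed
  show ?thesis
    unfolding clarke_KKT_def Let_def
  proof (intro conjI x allI feas exI[of _ mult] ballI)
    fix i show "0 \<le> mult $ i" by (rule mult)
    show "mult $ i * h x $ i = 0" using mult(2)[of i] by (auto simp: I_def)
  next
    fix d assume d: "d \<in> feasible_cone l u x"
    let ?S = "{\<xi>F + (\<Sum>i\<in>UNIV. mult $ i *\<^sub>R \<xi>H i) |\<xi>F \<xi>H. \<xi>F \<in> clarke_subdiff f x \<and>
                 (\<forall>i. \<xi>H i \<in> clarke_subdiff (\<lambda>x. h x $ i) x)}"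
    obtain \<xi>F where F: "\<xi>F \<in> clarke_subdiff f x" "ereal (\<xi>F \<bullet> d) = clarke_dderiv f x d"
      using clarke_subdiff_attains[OF lip_f] by blast
    have "\<forall>i. \<exists>\<xi>. \<xi> \<in> clarke_subdiff (\<lambda>x. h x $ i) x \<and>
        ereal (\<xi> \<bullet> d) = clarke_dderiv (\<lambda>x. h x $ i) x d"
      using clarke_subdiff_attains[OF lip] by blast
    then obtain \<xi>H where H: "\<And>i. \<xi>H i \<in> clarke_subdiff (\<lambda>x. h x $ i) x"
      "\<And>i. ereal (\<xi>H i \<bullet> d) = clarke_dderiv (\<lambda>x. h x $ i) x d" by metis
    let ?\<xi> = "\<xi>F + (\<Sum>i\<in>UNIV. mult $ i *\<^sub>R \<xi>H i)"
    have val: "d \<bullet> (a + (\<Sum>i\<in>UNIV. mult $ i *\<^sub>R c i)) = a \<bullet> d + (\<Sum>i\<in>UNIV. mult $ i * (c i \<bullet> d))"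
      for a and c :: "'m \<Rightarrow> real^'n"
      by (simp add: inner_add_right inner_sum_right inner_commute)
    have "?\<xi> \<in> ?S" using F(1) H(1) by blast
    moreover have "\<forall>\<eta>\<in>?S. d \<bullet> \<eta> \<le> d \<bullet> ?\<xi>"
    proof clarify
      fix a and c :: "'m \<Rightarrow> real^'n"
      assume a: "a \<in> clarke_subdiff f x" and c: "\<forall>i. c i \<in> clarke_subdiff (\<lambda>x. h x $ i) x"
      have "ereal (a \<bullet> d) \<le> ereal (\<xi>F \<bullet> d)" using a F(2) by (simp add: clarke_subdiff_def)
      moreover have "c i \<bullet> d \<le> \<xi>H i \<bullet> d" for i
      proof -
        have "ereal (c i \<bullet> d) \<le> ereal (\<xi>H i \<bullet> d)" using c H(2) by (simp add: clarke_subdiff_def)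
        then show ?thesis by simp
      qed
      ultimately show "d \<bullet> (a + (\<Sum>i\<in>UNIV. mult $ i *\<^sub>R c i)) \<le> d \<bullet> ?\<xi>"
        unfolding val using mult(1) by (intro add_mono sum_mono mult_left_mono) auto
    qed
    moreover have "0 \<le> d \<bullet> ?\<xi>"
    proof (rule field_le_epsilon)
      fix e :: real assume "0 < e"
      (* the share of e by which each of the weighted slopes may be raised *)
      define e' where "e' = e / (1 + (\<Sum>i\<in>UNIV. mult $ i))"
      have sum0: "0 \<le> (\<Sum>i\<in>UNIV. mult $ i)" using mult(1) by (simp add: sum_nonneg)
      then have "0 < e'" using \<open>0 < e\<close> by (simp add: e'_def)
      have "0 \<le> (\<xi>F \<bullet> d + e') + mult \<bullet> (\<chi> i. \<xi>H i \<bullet> d + e')"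
      proof (rule mult(3)[OF d])
        show "slope_le f x d (\<xi>F \<bullet> d + e')"
          using \<open>0 < e'\<close> by (intro slope_le_of_clarke_dderiv_less) (simp flip: F(2))
        fix i
        show "slope_le (\<lambda>x. h x $ i) x d ((\<chi> i. \<xi>H i \<bullet> d + e') $ i)"
          using \<open>0 < e'\<close> by (intro slope_le_of_clarke_dderiv_less) (simp flip: H(2))
      qed
      also have "\<dots> = d \<bullet> ?\<xi> + e' * (1 + (\<Sum>i\<in>UNIV. mult $ i))"
        unfolding val by (simp add: inner_vec_def algebra_simps sum.distrib sum_distrib_left)
      also have "\<dots> = d \<bullet> ?\<xi> + e" using sum0 by (simp add: e'_def)
      finally show "0 \<le> d \<bullet> ?\<xi> + e" .
    qed
    ultimately show "\<exists>\<xi>\<in>?S. (\<forall>\<eta>\<in>?S. d \<bullet> \<eta> \<le> d \<bullet> \<xi>) \<and> 0 \<le> d \<bullet> \<xi>" by blast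
  qed
qed

section \<open>The projection onto the box\<close>

lemma box_proj_in_cbox:
  fixes l u z :: "real^'n"
  assumes "x \<in> cbox l u" shows "box_proj l u z \<in> cbox l u"
proof -
  have "l $ i \<le> u $ i" for i
    using assms by (meson mem_box_cart(2) order_trans)
  then show ?thesis by (auto simp: mem_box_cart box_proj_def)
qed

lemma box_proj_id: "z \<in> cbox l u \<Longrightarrow> box_proj l u z = z"
  for z :: "real^'n"
  by (simp add: mem_box_cart box_proj_def vec_eq_iff)

lemma box_proj_nonexpansive: "dist (box_proj l u a) (box_proj l u b) \<le> dist a b"
  for a b :: "real^'n"
  unfolding dist_norm
  by (rule norm_le_componentwise_cart) (auto simp: box_proj_def max_def min_def)

text \<open>
  The projection does nothing along a fixed feasible direction, from all nearby points of the box at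
  once: a coordinate that moves towards a bound is not at that bound in the limit point.
\<close>

lemma feasible_direction_stays_in_box:
  fixes l u x d :: "real^'n"
  assumes x: "x \<in> cbox l u" and d: "d \<in> feasible_cone l u x"
  obtains \<epsilon> where "0 < \<epsilon>"
    "\<And>z t. z \<in> cbox l u \<Longrightarrow> dist z x < \<epsilon> \<Longrightarrow> 0 < t \<Longrightarrow> t < \<epsilon> \<Longrightarrow> z + t *\<^sub>R d \<in> cbox l u"
proof -
  have "\<forall>\<^sub>F p in nhds x \<times>\<^sub>F at_right 0. fst p \<in> cbox l u \<longrightarrow>
      l $ i \<le> (fst p + snd p *\<^sub>R d) $ i \<and> (fst p + snd p *\<^sub>R d) $ i \<le> u $ i" for i
  proof -
    have lim: "((\<lambda>p. (fst p + snd p *\<^sub>R d) $ i) \<longlongrightarrow> x $ i) (nhds x \<times>\<^sub>F at_right 0)"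
      by (intro tendsto_vec_nth tendsto_step)
    have xi: "l $ i \<le> x $ i" "x $ i \<le> u $ i" using x by (auto simp: mem_box_cart)
    have di: "x $ i = l $ i \<Longrightarrow> 0 \<le> d $ i" "x $ i = u $ i \<Longrightarrow> d $ i \<le> 0"
      using d by (auto simp: feasible_cone_def)
    consider "d $ i = 0" | "0 < d $ i" | "d $ i < 0" by linarith
    then show ?thesis
    proof cases
      case 1
      then show ?thesis by (simp add: mem_box_cart)
    next
      case 2
      with di xi have "x $ i < u $ i" by linarith
      from order_tendstoD(2)[OF lim this] eventually_step_pos[of x] show ?thesis
        by eventually_elim (use 2 in \<open>auto simp: mem_box_cart intro: add_increasing2\<close>)
    next
      case 3
      with di xi have "l $ i < x $ i" by linarith
      from order_tendstoD(1)[OF lim this] eventually_step_pos[of x] show ?thesis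
        by eventually_elim
          (use 3 in \<open>auto simp: mem_box_cart intro!: add_decreasing2 mult_nonneg_nonpos\<close>)
    qed
  qed
  then have "\<forall>\<^sub>F p in nhds x \<times>\<^sub>F at_right 0. \<forall>i. fst p \<in> cbox l u \<longrightarrow>
      l $ i \<le> (fst p + snd p *\<^sub>R d) $ i \<and> (fst p + snd p *\<^sub>R d) $ i \<le> u $ i"
    by (intro eventually_all_finite) auto
  then have "\<forall>\<^sub>F p in nhds x \<times>\<^sub>F at_right (0::real).
      fst p \<in> cbox l u \<longrightarrow> fst p + snd p *\<^sub>R d \<in> cbox l u"
    by eventually_elim (auto simp: mem_box_cart)
  then obtain P Q where PQ: "eventually P (nhds x)" "eventually Q (at_right (0::real))"
    "\<And>z t. P z \<Longrightarrow> Q t \<Longrightarrow> z \<in> cbox l u \<Longrightarrow> z + t *\<^sub>R d \<in> cbox l u"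
    unfolding eventually_prod_filter by auto
  from PQ(1) obtain e1 where e1: "0 < e1" "\<And>z. dist z x < e1 \<Longrightarrow> P z"
    unfolding eventually_nhds_metric by auto
  from PQ(2) obtain e2 where e2: "0 < e2" "\<And>t. 0 < t \<Longrightarrow> t < e2 \<Longrightarrow> Q t"
    unfolding eventually_at_right_field by auto
  show thesis
    by (rule that[of "min e1 e2"]) (use e1 e2 PQ(3) in auto)
qed

section \<open>Dense direction sequences\<close>

text \<open>
  Finitely many members of \<open>S\<close> cannot approximate all of a neighbourhood of \<open>e\<close> in the sphere unless
  they exhaust it, and from dimension two on the sphere is connected, hence without isolated points.
\<close>

lemma sphere_accumulates:
  fixes e :: "'a::euclidean_space"
  assumes dim: "2 \<le> DIM('a)" and e: "norm e = 1"
    and S: "\<And>z \<epsilon>. norm z = 1 \<Longrightarrow> 0 < \<epsilon> \<Longrightarrow> \<exists>s\<in>S. norm (s - z) \<le> \<epsilon>"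
    and "0 < \<epsilon>"
  shows "infinite {s\<in>S. norm (s - e) \<le> \<epsilon>}"
proof
  let ?A = "{s\<in>S. norm (s - e) \<le> \<epsilon>}"
  assume fin: "finite ?A"
  have "sphere 0 1 \<inter> ball e (\<epsilon> / 2) \<subseteq> ?A"
  proof (rule subsetI, rule ccontr)
    fix z assume z: "z \<in> sphere 0 1 \<inter> ball e (\<epsilon> / 2)" and "z \<notin> ?A"
    with fin obtain r where r: "0 < r" "\<And>s. s \<in> ?A \<Longrightarrow> r \<le> dist z s"
      using finite_set_avoid[OF fin, of z] by metis
    (* closer to z than all of A, yet close enough for s to lie in A *)
    define q where "q = min (r / 2) (\<epsilon> / 2)"
    have "0 < q" using r \<open>0 < \<epsilon>\<close> by (simp add: q_def)
    then obtain s where s: "s \<in> S" "norm (s - z) \<le> q" using S[of z q] z by auto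
    have "norm (s - e) \<le> norm (s - z) + norm (z - e)"
      by (rule order_trans[OF _ norm_triangle_ineq]) simp
    moreover have "norm (z - e) < \<epsilon> / 2" using z by (simp add: dist_norm norm_minus_commute)
    ultimately have "s \<in> ?A" using s by (simp add: q_def)
    with r(2) s(2) r(1) show False by (force simp: q_def dist_norm norm_minus_commute)
  qed
  with fin have fin': "finite (sphere 0 1 \<inter> ball e (\<epsilon> / 2))" by (rule rev_finite_subset)
  have "e islimpt sphere 0 1"
  proof (rule connected_imp_perfect)
    show "connected (sphere 0 1 :: 'a set)" using dim by (rule connected_sphere)
    show "e \<in> sphere 0 1" using e by simp
    show "sphere 0 1 \<noteq> {a}" for a :: 'a
    proof
      assume a: "sphere 0 1 = {a}"
      have "e \<in> sphere 0 1" "- e \<in> sphere 0 1" using e by auto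
      with a have "e = - e" by auto
      then have "2 *\<^sub>R e = 0" by (simp add: scaleR_2 eq_neg_iff_add_eq_0)
      with e show False by simp
    qed
  qed
  with fin' \<open>0 < \<epsilon>\<close> show False
    unfolding islimpt_eq_infinite_ball by (metis half_gt_zero inf_commute)
qed

lemma infinitely_many_close_directions:
  fixes d :: "nat \<Rightarrow> real^'n"
  assumes dense: "dense_in_sphere d K" and dim: "2 \<le> CARD('n)"
    and e: "norm e = 1" and "0 < \<epsilon>"
  shows "infinite {k\<in>K. norm (d k - e) \<le> \<epsilon>}"
proof
  assume "finite {k\<in>K. norm (d k - e) \<le> \<epsilon>}"
  then have "finite (d ` {k\<in>K. norm (d k - e) \<le> \<epsilon>})" by (rule finite_imageI)
  moreover have "d ` {k\<in>K. norm (d k - e) \<le> \<epsilon>} = {s \<in> d ` K. norm (s - e) \<le> \<epsilon>}" by auto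
  moreover have "infinite {s \<in> d ` K. norm (s - e) \<le> \<epsilon>}"
    using dense by (intro sphere_accumulates) (use assms in \<open>auto simp: dense_in_sphere_def\<close>)
  ultimately show False by simp
qed

lemma unit_vectors_one_dim:
  fixes e v :: "real^'n"
  assumes "CARD('n) = 1" "norm e = 1" "norm v = 1"
  shows "v = e \<or> v = - e"
proof -
  obtain i :: 'n where i: "UNIV = {i}" using assms(1) by (auto simp: card_1_singleton_iff)
  have n: "norm w = \<bar>w $ i\<bar>" for w :: "real^'n"
    by (simp add: norm_vec_def i L2_set_def)
  have "v $ i = e $ i \<or> v $ i = - e $ i" using assms(2,3) unfolding n by linarith
  moreover have "j = i" for j using i by auto
  then have "w = w'" if "w $ i = w' $ i" for w w' :: "real^'n"
    using that by (metis vec_eq_iff)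
  ultimately show ?thesis by (metis vector_uminus_component)
qed

section \<open>One step of the algorithm\<close>

lemma expansion_loop_result:
  assumes "expansion_loop R l u \<gamma> \<delta> x \<zeta> p \<alpha> \<alpha>'" "0 < \<alpha>" "\<delta> \<in> {0<..<1}"
    "sufficient_decrease R l u \<gamma> x \<zeta> \<alpha> p"
  shows "\<alpha> \<le> \<alpha>' \<and> sufficient_decrease R l u \<gamma> x \<zeta> \<alpha>' p \<and>
    \<not> sufficient_decrease R l u \<gamma> x \<zeta> (\<alpha>' / \<delta>) p"
  using assms
proof (induction rule: expansion_loop.induct)
  case (expand \<alpha> \<alpha>')
  have "\<alpha> \<le> \<alpha> / \<delta>" using expand.prems by (simp add: field_simps)
  with expand show ?case by (auto simp: zero_less_divide_iff)
qed simp

text \<open>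
  What is known after a call: besides the accepted step, which trial steps were rejected. An
  expansion ends with a rejection at the next larger step \<open>\<alpha> / \<delta>\<close>.
\<close>

lemma projected_extrapolation_cases:
  assumes "projected_extrapolation R l u \<gamma> \<delta> \<alpha>t x d \<zeta> \<alpha> p" "0 < \<alpha>t" "\<delta> \<in> {0<..<1}"
  obtains (failure) "\<alpha> = 0" "\<not> sufficient_decrease R l u \<gamma> x \<zeta> \<alpha>t d"
      "\<not> sufficient_decrease R l u \<gamma> x \<zeta> \<alpha>t (- d)"
  | (forward) "\<alpha>t \<le> \<alpha>" "p = d" "sufficient_decrease R l u \<gamma> x \<zeta> \<alpha> p"
      "sufficient_decrease R l u \<gamma> x \<zeta> \<alpha>t d"
      "\<not> sufficient_decrease R l u \<gamma> x \<zeta> (\<alpha> / \<delta>) d"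
  | (backward) "\<alpha>t \<le> \<alpha>" "p = - d" "sufficient_decrease R l u \<gamma> x \<zeta> \<alpha> p"
      "\<not> sufficient_decrease R l u \<gamma> x \<zeta> \<alpha>t d"
      "\<not> sufficient_decrease R l u \<gamma> x \<zeta> (\<alpha> / \<delta>) (- d)"
proof -
  note def = assms(1)[unfolded projected_extrapolation_def]
  show thesis
  proof (cases "sufficient_decrease R l u \<gamma> x \<zeta> \<alpha>t d")
    case True
    with def have "p = d" "expansion_loop R l u \<gamma> \<delta> x \<zeta> d \<alpha>t \<alpha>" by auto
    with expansion_loop_result[OF this(2) assms(2,3) True] True show thesis
      by (intro forward) auto
  next
    case nf: False
    show thesis
    proof (cases "sufficient_decrease R l u \<gamma> x \<zeta> \<alpha>t (- d)")
      case True
      with def nf have "p = - d" "expansion_loop R l u \<gamma> \<delta> x \<zeta> (- d) \<alpha>t \<alpha>" by auto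
      with expansion_loop_result[OF this(2) assms(2,3) True] nf show thesis
        by (intro backward) auto
    qed (use nf def failure in auto)
  qed
qed

section \<open>Runs on an inexact objective\<close>

text \<open>
  The run sees the values of \<open>P\<close> only through \<open>R\<close>, with an error proportional to the accuracy.
\<close>

locale inexact_run =
  fixes R :: "real^'n \<Rightarrow> real \<Rightarrow> real" and P :: "real^'n \<Rightarrow> real"
    and l u x0 :: "real^'n" and \<gamma> \<delta> \<theta> \<sigma> :: real and d :: "nat \<Rightarrow> real^'n"
    and x :: "nat \<Rightarrow> real^'n" and \<alpha>t \<zeta> \<alpha> :: "nat \<Rightarrow> real" and dt :: "nat \<Rightarrow> real^'n"
    and L LP Plow :: real
  assumes run: "DFN_LLA_run R l u \<gamma> \<delta> \<theta> \<sigma> 0 x0 d x \<alpha>t \<zeta> \<alpha> dt"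
    and \<zeta>_init: "0 < \<zeta> 0"
    and \<gamma>: "0 < \<gamma>" and \<delta>: "\<delta> \<in> {0<..<1}" and \<theta>: "\<theta> \<in> {0<..<1}"
    and x0: "x0 \<in> cbox l u"
    and unit_dir: "\<And>k. norm (d k) = 1"
    and accuracy: "\<And>z \<zeta>. z \<in> cbox l u \<Longrightarrow> 0 < \<zeta> \<Longrightarrow> \<bar>R z \<zeta> - P z\<bar> \<le> L * \<zeta>"
    and lipschitz: "LP-lipschitz_on UNIV P"
    and lower: "\<And>z. z \<in> cbox l u \<Longrightarrow> Plow \<le> P z"
begin

lemma L_nonneg: "0 \<le> L"
  using accuracy[OF x0, of 1] by simp

lemma LP_nonneg: "0 \<le> LP"
  using lipschitz by (rule lipschitz_on_nonneg)

lemma extrapolation: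
  "projected_extrapolation R l u \<gamma> \<delta> (\<alpha>t k) (x k) (d k) (\<zeta> k) (\<alpha> k) (dt k)"
  using run by (simp add: DFN_LLA_run_def)

lemma failure_step:
  assumes "\<alpha> k = 0"
  shows "\<alpha>t (Suc k) = max 0 (\<theta> * \<alpha>t k)" "x (Suc k) = x k"
    "\<zeta> (Suc k) = (if (\<alpha>t (Suc k))^3 < \<zeta> k
       then max 0 (min (\<theta> * \<zeta> k) ((\<alpha>t (Suc k))^3)) else \<zeta> k)"
  using run assms by (simp_all add: DFN_LLA_run_def)

lemma success_step:
  assumes "0 < \<alpha> k"
  shows "\<alpha>t (Suc k) = \<alpha> k" "\<zeta> (Suc k) = \<zeta> k" "x (Suc k) \<in> cbox l u"
    "R (x (Suc k)) (\<zeta> k) \<le> R (box_proj l u (x k + \<alpha> k *\<^sub>R dt k)) (\<zeta> k)"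
  using run assms by (simp_all add: DFN_LLA_run_def)

lemma initial: "x 0 = x0" "root 3 (\<zeta> 0) \<le> \<alpha>t 0"
  using run by (simp_all add: DFN_LLA_run_def)

text \<open>
  The cubic coupling is built into the update rules: \<open>\<zeta>\<close> is lowered below the cube of the new
  tentative step whenever it would exceed it. Hence the error \<open>L * \<zeta>\<close> is negligible against the
  quadratic decrease that is asked for.
\<close>

lemma invariant: "x k \<in> cbox l u \<and> 0 < \<alpha>t k \<and> 0 < \<zeta> k \<and> \<zeta> k \<le> (\<alpha>t k)^3"
proof (induction k)
  case 0
  have "0 < root 3 (\<zeta> 0)" using \<zeta>_init by simp
  with initial(2) have "0 < \<alpha>t 0" by linarith
  have "\<zeta> 0 = (root 3 (\<zeta> 0))^3" using \<zeta>_init by simp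
  also have "\<dots> \<le> (\<alpha>t 0)^3"
    using initial(2) \<open>0 < root 3 (\<zeta> 0)\<close> by (intro power_mono) auto
  finally show ?case using x0 initial(1) \<zeta>_init \<open>0 < \<alpha>t 0\<close> by simp
next
  case (Suc k)
  then have IH: "x k \<in> cbox l u" "0 < \<alpha>t k" "0 < \<zeta> k" "\<zeta> k \<le> (\<alpha>t k)^3" by auto
  consider "\<alpha> k = 0" | "\<alpha>t k \<le> \<alpha> k"
    by (rule projected_extrapolation_cases[OF extrapolation[of k] IH(2) \<delta>]) auto
  then show ?case
  proof cases
    case 1
    note step = failure_step[OF 1]
    have pos: "0 < \<theta> * \<alpha>t k" "0 < \<theta> * \<zeta> k" using IH \<theta> by auto
    with step(1) have "0 < \<alpha>t (Suc k)" by simp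
    moreover from this have "0 < (\<alpha>t (Suc k))^3" by simp
    ultimately show ?thesis using IH pos(2) unfolding step(2,3) by auto
  next
    case 2
    with IH have "0 < \<alpha> k" by simp
    note step = success_step[OF this]
    have "(\<alpha>t k)^3 \<le> (\<alpha> k)^3" using 2 IH(2) by (intro power_mono) auto
    with IH(4) have "\<zeta> k \<le> (\<alpha> k)^3" by linarith
    with IH \<open>0 < \<alpha> k\<close> step show ?thesis by simp
  qed
qed

lemma in_box: "x k \<in> cbox l u" and step_pos: "0 < \<alpha>t k" and accuracy_pos: "0 < \<zeta> k"
  and accuracy_le_cube: "\<zeta> k \<le> (\<alpha>t k)^3"
  using invariant by auto

lemmas extrapolation_cases = projected_extrapolation_cases[OF extrapolation step_pos \<delta>]

lemma accuracy_decrease: "\<zeta> (Suc k) \<le> \<theta> * \<zeta> k \<or> \<zeta> (Suc k) = \<zeta> k"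
proof (rule extrapolation_cases[of k])
  assume "\<alpha> k = 0"
  from failure_step(3)[OF this] accuracy_pos[of k] \<theta> show ?thesis
    by (auto simp: max_def min_def)
qed (use success_step(2)[of k] step_pos[of k] in auto)

text \<open>
  The values \<open>R (x k) (\<zeta> k)\<close> need not decrease: they may rise when the accuracy changes, by at most
  \<open>L * (\<zeta> k + \<zeta> (Suc k))\<close>. As the accuracy then shrinks by the factor \<open>\<theta>\<close>, a suitable multiple of
  it pays for the rise.
\<close>

definition potential :: "nat \<Rightarrow> real" where
  "potential k = R (x k) (\<zeta> k) + L * (1 + \<theta>) / (1 - \<theta>) * \<zeta> k"

lemma potential_decrease: "potential (Suc k) \<le> potential k - \<gamma> * (\<alpha> k)\<^sup>2"
proof -
  have success: ?thesis if "\<alpha>t k \<le> \<alpha> k" "sufficient_decrease R l u \<gamma> (x k) (\<zeta> k) (\<alpha> k) (dt k)"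
  proof -
    have "0 < \<alpha> k" using that(1) step_pos[of k] by linarith
    from success_step(2,4)[OF this] that(2) show ?thesis
      by (simp add: sufficient_decrease_def potential_def)
  qed
  show ?thesis
  proof (rule extrapolation_cases[of k])
    assume "\<alpha> k = 0"
    note step = failure_step(2)[OF this]
    consider "\<zeta> (Suc k) = \<zeta> k" | "\<zeta> (Suc k) \<le> \<theta> * \<zeta> k" using accuracy_decrease by blast
    then show ?thesis
    proof cases
      case 1
      with step \<open>\<alpha> k = 0\<close> show ?thesis by (simp add: potential_def)
    next
      case 2
      define C where "C = L * (1 + \<theta>) / (1 - \<theta>)"
      have "R (x k) (\<zeta> (Suc k)) \<le> R (x k) (\<zeta> k) + L * (\<zeta> k + \<zeta> (Suc k))"
        using accuracy[OF in_box[of k] accuracy_pos[of k]]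
          accuracy[OF in_box[of k] accuracy_pos[of "Suc k"]]
        by (simp add: algebra_simps abs_le_iff)
      moreover have "\<zeta> k + \<zeta> (Suc k) \<le> (1 + \<theta>) / (1 - \<theta>) * (\<zeta> k - \<zeta> (Suc k))"
        using 2 \<theta> by (simp add: field_simps)
      from mult_left_mono[OF this L_nonneg]
      have "L * (\<zeta> k + \<zeta> (Suc k)) \<le> C * (\<zeta> k - \<zeta> (Suc k))"
        by (simp add: C_def mult.assoc)
      ultimately show ?thesis using \<open>\<alpha> k = 0\<close>
        unfolding potential_def step C_def[symmetric] by (simp add: algebra_simps)
    qed
  qed (use success in auto)
qed

lemma accuracy_le_initial: "\<zeta> k \<le> \<zeta> 0"
proof (induction k)
  case (Suc k)
  have "\<theta> * \<zeta> k \<le> 1 * \<zeta> k" using \<theta> accuracy_pos[of k] by (intro mult_right_mono) auto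
  with Suc accuracy_decrease[of k] show ?case by linarith
qed simp

text \<open>The potential is bounded below, so the decreases \<open>\<gamma> * (\<alpha> k)\<^sup>2\<close> are summable.\<close>

lemma accepted_steps_vanish: "\<alpha> \<longlonglongrightarrow> 0"
proof -
  have "(\<Sum>k<n. \<gamma> * (\<alpha> k)\<^sup>2) \<le> potential 0 - potential n" for n
    by (induction n) (use potential_decrease in \<open>auto intro: order_trans[rotated] simp: algebra_simps add_mono\<close>)
  moreover have "Plow - L * \<zeta> 0 \<le> potential n" for n
  proof -
    have "P (x n) - L * \<zeta> n \<le> R (x n) (\<zeta> n)"
      using accuracy[OF in_box accuracy_pos, of n n] by (simp add: abs_le_iff)
    moreover have "L * \<zeta> n \<le> L * \<zeta> 0" by (intro mult_left_mono accuracy_le_initial L_nonneg)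
    moreover have "0 \<le> L * (1 + \<theta>) / (1 - \<theta>) * \<zeta> n"
      using L_nonneg \<theta> accuracy_pos[of n] by auto
    ultimately show ?thesis using lower[OF in_box, of n] unfolding potential_def by linarith
  qed
  ultimately have bound: "(\<Sum>k<n. \<gamma> * (\<alpha> k)\<^sup>2) \<le> potential 0 - (Plow - L * \<zeta> 0)" for n
    by (smt (verit))
  then have "summable (\<lambda>k. \<gamma> * (\<alpha> k)\<^sup>2)"
    using \<gamma> by (intro bounded_imp_summable[where B = "potential 0 - (Plow - L * \<zeta> 0)"])
      
        (use bound[of "Suc _"] in \<open>simp_all only: lessThan_Suc_atMost, simp\<close>)
  from summable_LIMSEQ_zero[OF this] have "(\<lambda>k. \<gamma> * (\<alpha> k)\<^sup>2 / \<gamma>) \<longlonglongrightarrow> 0 / \<gamma>"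
    using \<gamma> by (intro tendsto_divide) auto
  then have "(\<lambda>k. (\<alpha> k)\<^sup>2) \<longlonglongrightarrow> 0" using \<gamma> by simp
  from tendsto_real_sqrt[OF this] show ?thesis by (simp add: tendsto_rabs_zero_iff)
qed

text \<open>
  The next tentative step is the accepted step or \<open>\<theta>\<close> times the present one, so from the time when
  accepted steps stay below \<open>e / 2\<close> it decays geometrically until it is below \<open>e / 2\<close> too.
\<close>

lemma tentative_steps_vanish: "\<alpha>t \<longlonglongrightarrow> 0"
proof (rule LIMSEQ_I)
  fix e :: real assume "0 < e"
  obtain N where N: "\<And>k. k \<ge> N \<Longrightarrow> norm (\<alpha> k) < e / 2"
    using LIMSEQ_D[OF accepted_steps_vanish, of "e / 2"] \<open>0 < e\<close> by auto
  have bound: "\<alpha>t (N + j) \<le> max (e / 2) (\<theta>^j * \<alpha>t N)" for j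
  proof (induction j)
    case (Suc j)
    show ?case
    proof (rule extrapolation_cases[of "N + j"])
      assume "\<alpha> (N + j) = 0"
      with failure_step(1) \<theta> step_pos[of "N + j"] have "\<alpha>t (N + Suc j) = \<theta> * \<alpha>t (N + j)"
        by simp
      also have "\<dots> \<le> \<theta> * max (e / 2) (\<theta>^j * \<alpha>t N)" using \<theta> Suc by (intro mult_left_mono) auto
      also have "\<dots> \<le> max (e / 2) (\<theta>^Suc j * \<alpha>t N)"
      proof -
        have "\<theta> * (e / 2) \<le> 1 * (e / 2)" using \<theta> \<open>0 < e\<close> by (intro mult_right_mono) auto
        then have "max (\<theta> * (e / 2)) (\<theta> * (\<theta>^j * \<alpha>t N)) \<le> max (e / 2) (\<theta> * (\<theta>^j * \<alpha>t N))"
          by (intro max.mono) auto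
        moreover have "\<theta> * max (e / 2) (\<theta>^j * \<alpha>t N) =
            max (\<theta> * (e / 2)) (\<theta> * (\<theta>^j * \<alpha>t N))"
          using \<theta> by (intro max_mult_distrib_left[THEN trans]) simp
        ultimately show ?thesis by (simp only: power_Suc mult.assoc)
      qed
      finally show ?case .
    qed (use success_step(1)[of "N + j"] step_pos[of "N + j"] N[of "N + j"] in auto)
  qed simp
  have "(\<lambda>j. \<theta>^j * \<alpha>t N) \<longlonglongrightarrow> 0 * \<alpha>t N"
    using \<theta> by (intro tendsto_mult_right LIMSEQ_power_zero) auto
  then have "(\<lambda>j. \<theta>^j * \<alpha>t N) \<longlonglongrightarrow> 0" by simp
  from LIMSEQ_D[OF this \<open>0 < e\<close>] obtain J where J: "\<And>j. j \<ge> J \<Longrightarrow> norm (\<theta>^j * \<alpha>t N) < e"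
    by auto
  have "norm (\<alpha>t k - 0) < e" if "k \<ge> N + J" for k
  proof -
    from that obtain j where k: "k = N + j" and "j \<ge> J" by (metis add.assoc le_Suc_ex le_add1)
    from J[OF \<open>j \<ge> J\<close>] bound[of j] \<open>0 < e\<close> step_pos[of k] show ?thesis unfolding k by auto
  qed
  then show "\<exists>no. \<forall>k\<ge>no. norm (\<alpha>t k - 0) < e" by blast
qed

text \<open>
  Along a descent direction of the exact function, every short enough step passes the decrease
  test, also from a nearby point and in a nearby direction: the gain is linear in the step, while
  the test asks for a quadratic gain and the errors are cubic.
\<close>

lemma descent_is_accepted:
  assumes xbar: "xbar \<in> cbox l u" and e: "e \<in> feasible_cone l u xbar"
    and slope: "slope_le P xbar e a" "a < 0"
  obtains \<tau> \<eta> where "0 < \<tau>" "0 < \<eta>"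
    "\<And>z t p \<zeta>. z \<in> cbox l u \<Longrightarrow> dist z xbar < \<tau> \<Longrightarrow> 0 < t \<Longrightarrow> t < \<tau> \<Longrightarrow> norm (p - e) \<le> \<eta> \<Longrightarrow>
       0 < \<zeta> \<Longrightarrow> \<zeta> \<le> t^3 \<Longrightarrow> sufficient_decrease R l u \<gamma> z \<zeta> t p"
proof -
  obtain e1 where e1: "0 < e1"
    "\<And>z t. dist z xbar < e1 \<Longrightarrow> 0 < t \<Longrightarrow> t < e1 \<Longrightarrow> P (z + t *\<^sub>R e) - P z \<le> a * t"
    by (rule slope_leD[OF slope(1)]) (erule that, blast)
  obtain e2 where e2: "0 < e2"
    "\<And>z t. z \<in> cbox l u \<Longrightarrow> dist z xbar < e2 \<Longrightarrow> 0 < t \<Longrightarrow> t < e2 \<Longrightarrow> z + t *\<^sub>R e \<in> cbox l u"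
    by (rule feasible_direction_stays_in_box[OF xbar e]) (erule that, blast)
  (* Half of the linear gain - a * t pays for the deviation of the direction, the other half for
     the quadratic decrease and twice the evaluation error. *)
  define \<eta> where "\<eta> = - a / (2 * (LP + 1))"
  define t0 where "t0 = - a / (2 * (2 * L + \<gamma>))"
  define \<tau> where "\<tau> = Min {e1, e2, 1, t0}"
  have "0 < \<eta>" using slope(2) LP_nonneg by (simp add: \<eta>_def divide_neg_pos)
  have "0 < t0" using slope(2) L_nonneg \<gamma> by (simp add: t0_def divide_neg_pos)
  have "LP * \<eta> \<le> - a / 2"
  proof -
    have "LP * \<eta> \<le> (LP + 1) * \<eta>" using \<open>0 < \<eta>\<close> by simp
    also have "\<dots> = - a / 2"
    proof -
      have "LP + 1 \<noteq> 0" using LP_nonneg by linarith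
      then show ?thesis unfolding \<eta>_def by (simp add: divide_simps)
    qed
    finally show ?thesis .
  qed
  show thesis
  proof
    show "0 < \<tau>" using e1(1) e2(1) \<open>0 < t0\<close> by (simp add: \<tau>_def)
    show "0 < \<eta>" by fact
    fix z t p and \<zeta> :: real
    assume z: "z \<in> cbox l u" "dist z xbar < \<tau>" and t: "0 < t" "t < \<tau>"
      and p: "norm (p - e) \<le> \<eta>" and \<zeta>: "0 < \<zeta>" "\<zeta> \<le> t^3"
    have small: "dist z xbar < e1" "dist z xbar < e2" "t < e1" "t < e2" "t < 1" "t < t0"
      using z(2) t(2) by (auto simp: \<tau>_def)
    let ?w = "box_proj l u (z + t *\<^sub>R p)"
    have "z + t *\<^sub>R e \<in> cbox l u" using e2(2) z(1) small t(1) by blast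
    then have "dist ?w (z + t *\<^sub>R e) \<le> dist (z + t *\<^sub>R p) (z + t *\<^sub>R e)"
      using box_proj_nonexpansive[of l u "z + t *\<^sub>R p" "z + t *\<^sub>R e"] by (simp add: box_proj_id)
    also have "\<dots> = t * norm (p - e)" using t(1) by (simp add: dist_norm flip: scaleR_diff_right)
    also have "\<dots> \<le> t * \<eta>" using p t(1) by simp
    finally have "LP * dist ?w (z + t *\<^sub>R e) \<le> LP * (t * \<eta>)" by (intro mult_left_mono LP_nonneg)
    moreover have "dist (P ?w) (P (z + t *\<^sub>R e)) \<le> LP * dist ?w (z + t *\<^sub>R e)"
      by (rule lipschitz_onD[OF lipschitz]) auto
    ultimately have 1: "P ?w \<le> P (z + t *\<^sub>R e) + LP * (t * \<eta>)" by (simp add: dist_real_def abs_le_iff)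
    have 2: "P (z + t *\<^sub>R e) \<le> P z + a * t" using e1(2)[OF small(1) t(1) small(3)] by simp
    have "L * \<zeta> \<le> L * t^3" using \<zeta>(2) by (intro mult_left_mono L_nonneg)
    also have "\<dots> \<le> L * t\<^sup>2"
      using t(1) small(5) by (intro mult_left_mono L_nonneg power_decreasing) auto
    finally have 3: "L * \<zeta> \<le> L * t\<^sup>2" .
    have 4: "R ?w \<zeta> \<le> P ?w + L * \<zeta>" "P z \<le> R z \<zeta> + L * \<zeta>"
      using accuracy[OF box_proj_in_cbox[OF z(1)] \<zeta>(1), of "z + t *\<^sub>R p"] accuracy[OF z(1) \<zeta>(1)]
      by (auto simp: abs_le_iff)
    have "(2 * L + \<gamma>) * t \<le> (2 * L + \<gamma>) * t0" using small(6) L_nonneg \<gamma> by simp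
    also have "\<dots> = - a / 2"
    proof -
      have "2 * L + \<gamma> \<noteq> 0" using L_nonneg \<gamma> by linarith
      then show ?thesis unfolding t0_def by (simp add: divide_simps)
    qed
    finally have "LP * \<eta> + a + (2 * L + \<gamma>) * t \<le> 0" using \<open>LP * \<eta> \<le> - a / 2\<close> by simp
    from mult_right_mono[OF this, of t] t(1)
    have "LP * (t * \<eta>) + a * t + 2 * (L * t\<^sup>2) + \<gamma> * t\<^sup>2 \<le> 0"
      by (simp add: algebra_simps power2_eq_square)
    with 1 2 3 4 show "sufficient_decrease R l u \<gamma> z \<zeta> t p"
      unfolding sufficient_decrease_def by linarith
  qed
qed

text \<open>
  Every iteration leaves behind a rejected step along \<open>d k\<close>; and a step rejected along \<open>- d k\<close>,
  unless the first trial along \<open>d k\<close> was already accepted.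
\<close>

lemma rejected_steps:
  assumes "0 < \<tau>"
  shows "\<forall>\<^sub>F k in sequentially.
    (\<exists>t. \<alpha>t k \<le> t \<and> t < \<tau> \<and> \<not> sufficient_decrease R l u \<gamma> (x k) (\<zeta> k) t (d k)) \<and>
    (sufficient_decrease R l u \<gamma> (x k) (\<zeta> k) (\<alpha>t k) (d k) \<or>
     (\<exists>t. \<alpha>t k \<le> t \<and> t < \<tau> \<and> \<not> sufficient_decrease R l u \<gamma> (x k) (\<zeta> k) t (- d k)))"
proof -
  have "(\<lambda>k. \<alpha> k / \<delta>) \<longlonglongrightarrow> 0 / \<delta>" using \<delta> by (intro tendsto_divide accepted_steps_vanish) auto
  then have "\<forall>\<^sub>F k in sequentially. \<alpha> k / \<delta> < \<tau>" using assms by (intro order_tendstoD(2)) auto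
  moreover have "\<forall>\<^sub>F k in sequentially. \<alpha>t k < \<tau>"
    using tentative_steps_vanish assms by (intro order_tendstoD(2)) auto
  ultimately show ?thesis
  proof eventually_elim
    case (elim k)
    have le: "\<alpha>t k \<le> \<alpha> k / \<delta>" if "\<alpha>t k \<le> \<alpha> k"
    proof -
      have "\<alpha> k * \<delta> \<le> \<alpha> k * 1" using \<delta> that step_pos[of k] by (intro mult_left_mono) auto
      then have "\<alpha> k \<le> \<alpha> k / \<delta>" using \<delta> by (simp add: field_simps)
      with that show ?thesis by linarith
    qed
    show ?case
      by (rule extrapolation_cases[of k]) (use elim le in blast)+
  qed
qed

text \<open>
  In dimension one the unit sphere is discrete, so a dense family may contain a given direction
  \<open>e\<close> only finitely often, and then \<open>d k = - e\<close> almost always. Near a point where \<open>e\<close> descends,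
  \<open>- e\<close> ascends, so that the first trial along \<open>d k\<close> is rejected and \<open>- d k = e\<close> is tried as well.
\<close>

lemma opposite_trial_rejected:
  assumes dim: "CARD('n) = 1" and e: "norm e = 1"
    and slope: "slope_le P xbar e a" "a < 0"
  obtains \<tau> where "0 < \<tau>"
    "\<And>z t \<zeta>. z \<in> cbox l u \<Longrightarrow> dist z xbar < \<tau> \<Longrightarrow> 0 < t \<Longrightarrow> t < \<tau> \<Longrightarrow>
       0 < \<zeta> \<Longrightarrow> \<zeta> \<le> t^3 \<Longrightarrow> \<not> sufficient_decrease R l u \<gamma> z \<zeta> t (- e)"
proof -
  obtain e1 where e1: "0 < e1"
    "\<And>z t. dist z xbar < e1 \<Longrightarrow> 0 < t \<Longrightarrow> t < e1 \<Longrightarrow> P (z + t *\<^sub>R e) - P z \<le> a * t"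
    by (rule slope_leD[OF slope(1)]) (erule that, blast)
  define \<tau> where "\<tau> = min (e1 / 2) (\<gamma> / (2 * L + 1))"
  show thesis
  proof
    show "0 < \<tau>" using e1(1) \<gamma> L_nonneg by (simp add: \<tau>_def)
    fix z t and \<zeta> :: real
    assume z: "z \<in> cbox l u" "dist z xbar < \<tau>" and t: "0 < t" "t < \<tau>"
      and \<zeta>: "0 < \<zeta>" "\<zeta> \<le> t^3"
    let ?w = "box_proj l u (z + t *\<^sub>R - e)"
    obtain i :: 'n where i: "UNIV = {i}" using dim by (auto simp: card_1_singleton_iff)
    then have all_i: "j = i" for j by auto
    have "\<bar>e $ i\<bar> = 1" using e by (simp add: norm_vec_def i L2_set_def)
    then have ei: "e $ i = 1 \<or> e $ i = - 1" by linarith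
    (* the distance actually travelled, which the projection may have shortened *)
    define s where "s = (z - ?w) $ i * e $ i"
    have zi: "l $ i \<le> z $ i" "z $ i \<le> u $ i" using z(1) by (auto simp: mem_box_cart)
    have s: "0 \<le> s" "s \<le> t"
      using ei zi t(1) unfolding s_def by (auto simp: box_proj_def max_def min_def)
    have "(z - ?w) $ j = (s *\<^sub>R e) $ j" for j
      unfolding all_i[of j] using ei by (auto simp: s_def)
    then have w: "?w + s *\<^sub>R e = z" by (metis diff_add_cancel add.commute vec_eq_iff)
    have "P z \<le> P ?w"
    proof (cases "s = 0")
      case True
      with w show ?thesis by simp
    next
      case False
      have "dist ?w z = s" using w s(1) e
        by (metis abs_of_nonneg add_diff_cancel_left' dist_commute dist_norm mult.right_neutral norm_scaleR)
      moreover have "s < e1 / 2" "dist z xbar < e1 / 2" using s t z(2) by (auto simp: \<tau>_def)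
      ultimately have "dist ?w xbar < e1" "s < e1" "0 < s"
        using dist_triangle[of ?w xbar z] s False by auto
      from e1(2)[OF this(1,3,2)] w have "P z \<le> P ?w + a * s" by simp
      moreover have "a * s \<le> 0" using slope(2) s(1) by (simp add: mult_nonpos_nonneg)
      ultimately show ?thesis by simp
    qed
    show "\<not> sufficient_decrease R l u \<gamma> z \<zeta> t (- e)"
    proof
      assume "sufficient_decrease R l u \<gamma> z \<zeta> t (- e)"
      then have "R ?w \<zeta> \<le> R z \<zeta> - \<gamma> * t\<^sup>2" by (simp add: sufficient_decrease_def)
      moreover have "P ?w \<le> R ?w \<zeta> + L * \<zeta>" "R z \<zeta> \<le> P z + L * \<zeta>"
        using accuracy[OF box_proj_in_cbox[OF z(1)] \<zeta>(1), of "z + t *\<^sub>R - e"] accuracy[OF z(1) \<zeta>(1)]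
        by (auto simp: abs_le_iff)
      moreover have "L * \<zeta> \<le> L * t^3" using \<zeta>(2) by (intro mult_left_mono L_nonneg)
      ultimately have "\<gamma> * t\<^sup>2 \<le> 2 * L * t^3" using \<open>P z \<le> P ?w\<close> by linarith
      then have "\<gamma> * t\<^sup>2 \<le> 2 * L * t * t\<^sup>2" by (simp add: power3_eq_cube power2_eq_square)
      then have "\<gamma> \<le> 2 * L * t" using t(1) by simp
      moreover have "t * (2 * L + 1) < \<gamma>"
        using t(2) L_nonneg by (simp add: \<tau>_def pos_less_divide_eq)
      ultimately show False using t(1) by (simp add: algebra_simps)
    qed
  qed
qed

lemma limit_point_in_box:
  assumes "infinite K" "(x \<longlongrightarrow> xbar) (inf sequentially (principal K))"
  shows "xbar \<in> cbox l u"
proof (rule Lim_in_closed_set[OF closed_cbox _ _ assms(2)])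
  show "inf sequentially (principal K) \<noteq> bot"
  proof
    assume "inf sequentially (principal K) = bot"
    then have "\<forall>\<^sub>F k in inf sequentially (principal K). False" by simp
    then obtain N where "\<And>k. k \<ge> N \<Longrightarrow> k \<notin> K"
      by (auto simp: eventually_inf_principal eventually_sequentially)
    then show False using assms(1) unfolding infinite_nat_iff_unbounded_le by blast
  qed
qed (simp add: in_box)

text \<open>
  Stationarity for the exact function. After normalising the descent direction to \<open>e\<close>, the proof
  looks for late iterations whose rejected steps lie along, or close to, \<open>e\<close>: those with \<open>d k\<close> near
  \<open>e\<close>, or in dimension one possibly those with \<open>d k = - e\<close>.
\<close>

theorem limit_point_no_descent:
  assumes K: "infinite K" and conv: "(x \<longlongrightarrow> xbar) (inf sequentially (principal K))"
    and dense: "dense_in_sphere d K"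
    and c: "c \<in> feasible_cone l u xbar" and slope: "slope_le P xbar c a" and a: "a < 0"
  shows False
proof -
  have xbar: "xbar \<in> cbox l u" using K conv by (rule limit_point_in_box)
  have "c \<noteq> 0"
  proof
    assume "c = 0"
    with slope have "slope_le P xbar 0 a" by simp
    from slope_le_zero_direction[OF this] a show False by simp
  qed
  define e where "e = (1 / norm c) *\<^sub>R c"
  have e: "norm e = 1" "e \<in> feasible_cone l u xbar" "slope_le P xbar e (1 / norm c * a)"
    using \<open>c \<noteq> 0\<close> by (auto simp: e_def intro: feasible_cone_scale[OF c])
      (use slope_le_scale[OF slope, of "1 / norm c"] \<open>c \<noteq> 0\<close> in simp)
  have neg: "1 / norm c * a < 0" using \<open>c \<noteq> 0\<close> a by (simp add: divide_neg_pos)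
  obtain \<tau> \<eta> where \<tau>: "0 < \<tau>" and \<eta>: "0 < \<eta>" and accepted:
    "\<And>z t p \<zeta>. z \<in> cbox l u \<Longrightarrow> dist z xbar < \<tau> \<Longrightarrow> 0 < t \<Longrightarrow> t < \<tau> \<Longrightarrow> norm (p - e) \<le> \<eta> \<Longrightarrow>
       0 < \<zeta> \<Longrightarrow> \<zeta> \<le> t^3 \<Longrightarrow> sufficient_decrease R l u \<gamma> z \<zeta> t p"
    by (rule descent_is_accepted[OF xbar e(2,3) neg]) (erule that, assumption, blast)
  have near: "\<forall>\<^sub>F k in sequentially. k \<in> K \<longrightarrow> dist (x k) xbar < r" if "0 < r" for r
    using tendstoD[OF conv that] by (simp add: eventually_inf_principal)
  have no_rejection: "sufficient_decrease R l u \<gamma> (x k) (\<zeta> k) t p"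
    if "dist (x k) xbar < \<tau>" "\<alpha>t k \<le> t" "t < \<tau>" "norm (p - e) \<le> \<eta>" for k t p
  proof (rule accepted[OF in_box that(1) _ that(3,4) accuracy_pos])
    show "0 < t" using step_pos[of k] that(2) by linarith
    have "(\<alpha>t k)^3 \<le> t^3" using step_pos[of k] that(2) by (intro power_mono) auto
    with accuracy_le_cube[of k] show "\<zeta> k \<le> t^3" by linarith
  qed
  have close_contra: False if inf: "infinite {k\<in>K. norm (d k - e) \<le> \<eta>}"
  proof -
    from eventually_conj[OF near[OF \<tau>] rejected_steps[OF \<tau>]]
    obtain N where N: "\<And>k. k \<ge> N \<Longrightarrow> k \<in> K \<Longrightarrow> dist (x k) xbar < \<tau>"
      "\<And>k. k \<ge> N \<Longrightarrow> \<exists>t. \<alpha>t k \<le> t \<and> t < \<tau> \<and> \<not> sufficient_decrease R l u \<gamma> (x k) (\<zeta> k) t (d k)"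
      unfolding eventually_sequentially by blast
    obtain k where "k \<ge> N" "k \<in> K" "norm (d k - e) \<le> \<eta>"
      using inf unfolding infinite_nat_iff_unbounded_le by blast
    with N no_rejection show False by blast
  qed
  show False
  proof (cases "2 \<le> CARD('n)")
    case True
    from close_contra[OF infinitely_many_close_directions[OF dense True e(1) \<eta>]] show False .
  next
    case False
    then have one: "CARD('n) = 1" using zero_less_card_finite[where 'a = 'n] by linarith
    show False
    proof (cases "infinite {k\<in>K. d k = e}")
      case True
      have "{k\<in>K. d k = e} \<subseteq> {k\<in>K. norm (d k - e) \<le> \<eta>}" using \<eta> by auto
      from close_contra[OF infinite_super[OF this True]] show False .
    next
      case False
      have "infinite (K - {k\<in>K. d k = e})" using False K by (intro Diff_infinite_finite) auto
      moreover have "K - {k\<in>K. d k = e} \<subseteq> {k\<in>K. d k = - e}"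
        using unit_vectors_one_dim[OF one e(1) unit_dir] by auto
      ultimately have inf: "infinite {k\<in>K. d k = - e}" by (rule infinite_super[rotated])
      obtain \<tau>' where \<tau>': "0 < \<tau>'" and rejected:
        "\<And>z t \<zeta>. z \<in> cbox l u \<Longrightarrow> dist z xbar < \<tau>' \<Longrightarrow> 0 < t \<Longrightarrow> t < \<tau>' \<Longrightarrow>
           0 < \<zeta> \<Longrightarrow> \<zeta> \<le> t^3 \<Longrightarrow> \<not> sufficient_decrease R l u \<gamma> z \<zeta> t (- e)"
        by (rule opposite_trial_rejected[OF one e(1,3) neg]) (erule that, blast)
      have "\<forall>\<^sub>F k in sequentially. \<alpha>t k < \<tau>'"
        using tentative_steps_vanish \<tau>' by (intro order_tendstoD(2)) auto
      from eventually_conj[OF this eventually_conj[OF near[OF \<tau>']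
          eventually_conj[OF near[OF \<tau>] rejected_steps[OF \<tau>]]]]
      obtain N where N: "\<And>k. k \<ge> N \<Longrightarrow> \<alpha>t k < \<tau>'"
        "\<And>k. k \<ge> N \<Longrightarrow> k \<in> K \<Longrightarrow> dist (x k) xbar < \<tau>'"
        "\<And>k. k \<ge> N \<Longrightarrow> k \<in> K \<Longrightarrow> dist (x k) xbar < \<tau>"
        "\<And>k. k \<ge> N \<Longrightarrow> sufficient_decrease R l u \<gamma> (x k) (\<zeta> k) (\<alpha>t k) (d k) \<or>
          (\<exists>t. \<alpha>t k \<le> t \<and> t < \<tau> \<and> \<not> sufficient_decrease R l u \<gamma> (x k) (\<zeta> k) t (- d k))"
        unfolding eventually_sequentially by blast
      obtain k where k: "k \<ge> N" "k \<in> K" "d k = - e"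
        using inf unfolding infinite_nat_iff_unbounded_le by blast
      have "\<not> sufficient_decrease R l u \<gamma> (x k) (\<zeta> k) (\<alpha>t k) (d k)"
        unfolding k(3)
        by (rule rejected[OF in_box N(2)[OF k(1,2)] step_pos N(1)[OF k(1)] accuracy_pos
              accuracy_le_cube])
      with N(4)[OF k(1)] k(3) obtain t where
        "\<alpha>t k \<le> t" "t < \<tau>" "\<not> sufficient_decrease R l u \<gamma> (x k) (\<zeta> k) t e" by auto
      with no_rejection[OF N(3)[OF k(1,2)], of t e] \<eta> show False by simp
    qed
  qed
qed

end

section \<open>Stationarity of limit points\<close>

text \<open>
  Solving the lower level only up to \<open>\<zeta>\<close> costs the penalty function an error linear in \<open>\<zeta>\<close>,
  because upper-level objective and constraints are Lipschitz in the response.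
\<close>

lemma perturbed_penalty_error:
  fixes F :: "(real^'n) \<times> (real^'p) \<Rightarrow> real" and H :: "(real^'n) \<times> (real^'p) \<Rightarrow> real^'m"
  assumes F: "LF-lipschitz_on UNIV (\<lambda>z. F (x, z))"
    and H: "\<And>i. (LH $ i)-lipschitz_on UNIV (\<lambda>z. H (x, z) $ i)"
    and "0 < \<rho>" and near: "norm (ytilde x \<zeta> - y x) \<le> \<zeta>"
  shows "\<bar>perturbed_penalty F H ytilde \<rho> x \<zeta> -
      (at_response F y x + 1 / \<rho> * violation (at_response H y x))\<bar>
    \<le> (LF + 1 / \<rho> * (\<Sum>i\<in>UNIV. LH $ i)) * \<zeta>"
proof -
  let ?v = "violation (H (x, ytilde x \<zeta>)) - violation (H (x, y x))"
  have lip: "\<bar>g (ytilde x \<zeta>) - g (y x)\<bar> \<le> C * \<zeta>" if "C-lipschitz_on UNIV g" for g C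
  proof -
    have "dist (g (ytilde x \<zeta>)) (g (y x)) \<le> C * dist (ytilde x \<zeta>) (y x)"
      by (rule lipschitz_onD[OF that]) auto
    also have "\<dots> \<le> C * \<zeta>"
      using near lipschitz_on_nonneg[OF that] by (simp add: dist_norm mult_left_mono)
    finally show ?thesis by (simp add: dist_real_def)
  qed
  have "\<bar>?v\<bar> \<le> (\<Sum>i\<in>UNIV. (\<chi> i. LH $ i * \<zeta>) $ i)"
    by (rule violation_diff_le) (use lip[OF H] in simp)
  then have "\<bar>?v\<bar> \<le> (\<Sum>i\<in>UNIV. LH $ i) * \<zeta>" by (simp add: sum_distrib_right)
  then have "1 / \<rho> * \<bar>?v\<bar> \<le> 1 / \<rho> * ((\<Sum>i\<in>UNIV. LH $ i) * \<zeta>)"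
    using \<open>0 < \<rho>\<close> by (intro mult_left_mono) auto
  moreover have "\<bar>1 / \<rho> * ?v\<bar> = 1 / \<rho> * \<bar>?v\<bar>" using \<open>0 < \<rho>\<close> by (simp add: abs_mult)
  moreover have "perturbed_penalty F H ytilde \<rho> x \<zeta> -
      (at_response F y x + 1 / \<rho> * violation (at_response H y x)) =
      (F (x, ytilde x \<zeta>) - F (x, y x)) + 1 / \<rho> * ?v"
    by (simp add: perturbed_penalty_def at_response_def violation_def algebra_simps)
  moreover have "(LF + 1 / \<rho> * (\<Sum>i\<in>UNIV. LH $ i)) * \<zeta> =
      LF * \<zeta> + 1 / \<rho> * ((\<Sum>i\<in>UNIV. LH $ i) * \<zeta>)"
    by (simp add: algebra_simps)
  ultimately show ?thesis using lip[OF F] by linarith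
qed

theorem proposition9:
  fixes l u x0 :: "real^'n"
    and F f :: "(real^'n) \<times> (real^'p) \<Rightarrow> real"
    and H :: "(real^'n) \<times> (real^'p) \<Rightarrow> real^'m"
    and Z :: "(real^'p) set"
    and y :: "real^'n \<Rightarrow> real^'p"
    and ytilde :: "real^'n \<Rightarrow> real \<Rightarrow> real^'p"
    and LF LFbar Flow :: real
    and LH LHbar :: "real^'m"
    and \<gamma> \<delta> \<theta> \<sigma> :: real
    and d :: "nat \<Rightarrow> real^'n"
  assumes y_solution: "\<And>x. x \<in> cbox l u \<Longrightarrow> y x \<in> lower_level_solutions f Z x"
    and ytilde_accuracy:
      "\<And>x \<zeta>. x \<in> cbox l u \<Longrightarrow> 0 < \<zeta> \<Longrightarrow> norm (ytilde x \<zeta> - y x) \<le> \<zeta>"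
    and F_lipschitz: "\<And>x. LF-lipschitz_on UNIV (\<lambda>z. F (x, z))"
    and Fbar_lipschitz: "LFbar-lipschitz_on UNIV (at_response F y)"
    and Fbar_lower: "\<And>x. x \<in> cbox l u \<Longrightarrow> Flow \<le> at_response F y x"
    and H_lipschitz: "\<And>i x. (LH $ i)-lipschitz_on UNIV (\<lambda>z. H (x, z) $ i)"
    and Hbar_lipschitz: "\<And>i. (LHbar $ i)-lipschitz_on UNIV (\<lambda>x. at_response H y x $ i)"
    and emfcq: "EMFCQ l u (at_response H y)"
    and constants: "0 < \<gamma>" "\<delta> \<in> {0<..<1}" "\<theta> \<in> {0<..<1}" "\<sigma> \<in> {0<..<1}"
    and x0: "x0 \<in> cbox l u"
    and d: "\<And>k. norm (d k) = 1"
  shows "\<exists>\<rho>max>0. \<forall>\<rho>\<in>{0<..\<rho>max}. \<forall>x \<alpha>t \<zeta> \<alpha> dt xbar K.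
           DFN_LLA_run (perturbed_penalty F H ytilde \<rho>) l u \<gamma> \<delta> \<theta> \<sigma> 0 x0 d x \<alpha>t \<zeta> \<alpha> dt \<and>
           0 < \<zeta> 0 \<and>
           infinite K \<and> (x \<longlongrightarrow> xbar) (inf sequentially (principal K)) \<and>
           dense_in_sphere d K
           \<longrightarrow> clarke_KKT l u (at_response F y) (at_response H y) xbar"
proof -
  let ?F = "at_response F y" and ?H = "at_response H y"
  obtain \<rho>max where \<rho>max: "0 < \<rho>max"
    and threshold: "\<And>\<rho> x. \<rho> \<in> {0<..\<rho>max} \<Longrightarrow> x \<in> cbox l u \<Longrightarrow> \<not> (\<forall>i. ?H x $ i \<le> 0) \<Longrightarrow>
       \<exists>d\<in>feasible_cone l u x. \<exists>a<0. slope_le (\<lambda>x. ?F x + 1 / \<rho> * violation (?H x)) x d a"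
    by (rule penalty_threshold[OF emfcq Fbar_lipschitz Hbar_lipschitz]) (erule that, blast)
  show ?thesis
  proof (intro exI[of _ \<rho>max] conjI \<rho>max ballI allI impI, elim conjE)
    fix \<rho> x \<alpha>t \<zeta> \<alpha> dt xbar K
    assume \<rho>: "\<rho> \<in> {0<..\<rho>max}"
      and run: "DFN_LLA_run (perturbed_penalty F H ytilde \<rho>) l u \<gamma> \<delta> \<theta> \<sigma> 0 x0 d x \<alpha>t \<zeta> \<alpha> dt"
      and \<zeta>0: "0 < \<zeta> 0" and K: "infinite K" "(x \<longlongrightarrow> xbar) (inf sequentially (principal K))"
      and dense: "dense_in_sphere d K"
    let ?P = "\<lambda>x. ?F x + 1 / \<rho> * violation (?H x)"
    from \<rho> have "0 < \<rho>" by simp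
    interpret inexact_run "perturbed_penalty F H ytilde \<rho>" ?P l u x0 \<gamma> \<delta> \<theta> \<sigma> d x \<alpha>t \<zeta> \<alpha> dt
      "LF + 1 / \<rho> * (\<Sum>i\<in>UNIV. LH $ i)" "LFbar + 1 / \<rho> * (\<Sum>i\<in>UNIV. LHbar $ i)" Flow
    proof
      fix z assume "z \<in> cbox l u"
      from Fbar_lower[OF this] show "Flow \<le> ?P z"
        using \<open>0 < \<rho>\<close> violation_nonneg[of "?H z"] by (simp add: add_increasing2)
    next
      show "\<bar>perturbed_penalty F H ytilde \<rho> z \<zeta> - ?P z\<bar> \<le> (LF + 1 / \<rho> * (\<Sum>i\<in>UNIV. LH $ i)) * \<zeta>"
        if "z \<in> cbox l u" "0 < \<zeta>" for z \<zeta>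
        by (intro perturbed_penalty_error F_lipschitz H_lipschitz \<open>0 < \<rho>\<close> ytilde_accuracy that)
      show "(LFbar + 1 / \<rho> * (\<Sum>i\<in>UNIV. LHbar $ i))-lipschitz_on UNIV ?P"
        by (rule penalty_lipschitz[OF Fbar_lipschitz Hbar_lipschitz \<open>0 < \<rho>\<close>])
    qed (use run \<zeta>0 constants x0 d in simp_all)
    have xbar: "xbar \<in> cbox l u" using K by (rule limit_point_in_box)
    have no_descent: "\<not> slope_le ?P xbar c a" if "c \<in> feasible_cone l u xbar" "a < 0" for c a
      using limit_point_no_descent[OF K dense that(1) _ that(2)] by blast
    have "?H xbar $ i \<le> 0" for i
      using threshold[OF \<rho> xbar] no_descent by blast
    then show "clarke_KKT l u ?F ?H xbar"
      by (intro clarke_KKT_of_no_penalty_descent[OF Fbar_lipschitz Hbar_lipschitz \<open>0 < \<rho>\<close> xbar])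
        (use no_descent in auto)
  qed
qed

end
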